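(* Let $N\ge 1$ be an integer, and let $X_0,\dots,X_N$, $U_0,\dots,U_{N-1}$, $W_0,\dots,W_{N-1}$ be Banach spaces with the data $C,\Omega_k,A_k,B_k,T_k,h_k$ of the parametric convex discrete optimal control problem described in the context, with optimal value function $V:W\to[-\infty,+\infty]$ and solution map $S$. Let $\bar w=(\bar w_0,\dots,\bar w_{N-1})\in W$ be such that $V(\bar w)$ is finite, and let $(\bar x,\bar u)\in S(\bar w)$, where $\bar x=(\bar x_0,\dots,\bar x_N)$ and $\bar u=(\bar u_0,\dots,\bar u_{N-1})$. Suppose that $h_k$, $k=0,1,\dots,N$, are continuous and the interiors of $\Omega_k$, $k=0,1,\dots,N-1$, are nonempty. Suppose in addition that: (i) $\ker T^*\subset\ker M^*$; (ii) the operator $\Phi:W\times Z\to\widetilde X$ defined by $\Phi(w,z)=-Tw+Mz$ has closed range. If $\tilde w^*=(\tilde w_0^*,\dots,\tilde w_{N-1}^* )\in\partial V(\bar w)$, then there exist $x_0^*\in N(\bar x_0;C)$, $\tilde x^*=(\tilde x_1^*,\dots,\tilde x_N^* )\in\widetilde X^*$ and $u^*=(u_0^*,\dots,u_{N-1}^* )\in N(\bar u;\Omega)$ such that $$\begin{cases} \tilde x_N^*\in\partial h_N(\bar x_N),\\ \tilde x_k^*\in\partial_{x_k}h_k(\bar x_k,\bar u_k,\bar w_k)+A_k^*\tilde x_{k+1}^*, & k=1,2,\dots,N-1,\\ x_0^*\in-\partial_{x_0}h_0(\bar x_0,\bar u_0,\bar w_0)-A_0^*\tilde x_1^*,\\ u_k^*\in-\partial_{u_k}h_k(\bar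 x_k,\bar u_k,\bar w_k)-B_k^*\tilde x_{k+1}^*, & k=0,1,\dots,N-1,\\ \tilde w_k^*\in\partial_{w_k}h_k(\bar x_k,\bar u_k,\bar w_k)+T_k^*\tilde x_{k+1}^*, & k=0,1,\dots,N-1. \end{cases}$$
   Context: All Banach spaces are real. Data: convex sets $\Omega_k\subset U_k$ ($k=0,\dots,N-1$) and $C\subset X_0$; continuous linear operators $A_k:X_k\to X_{k+1}$, $B_k:U_k\to X_{k+1}$, $T_k:W_k\to X_{k+1}$ ($k=0,\dots,N-1$); convex functions $h_k:X_k\times U_k\times W_k\to\mathbb R$ ($k=0,\dots,N-1$) and $h_N:X_N\to\mathbb R$. Notation: $X=X_0\times\cdots\times X_N$, $\widetilde X=X_1\times\cdots\times X_N$, $U=U_0\times\cdots\times U_{N-1}$, $W=W_0\times\cdots\times W_{N-1}$, $Z=X\times U$, $\Omega=\Omega_0\times\cdots\times\Omega_{N-1}$. Control problem: for $w=(w_0,\dots,w_{N-1})\in W$, minimize $\sum_{k=0}^{N-1}h_k(x_k,u_k,w_k)+h_N(x_N)$ over all $(x,u)\in X\times U$ satisfying $x_{k+1}=A_kx_k+B_ku_k+T_kw_k$ and $u_k\in\Omega_k$ for $k=0,\dots,N-1$, and $x_0\in C$. $V(w)$ is the infimum of this problem (the optimal value function), and $S(w)$ is its set of solutions (minimizers) $(x,u)$. Operators: $M:Z\to\widetilde X$ is the continuous linear operator whose component in $X_{k+1}$ is $-A_kx_k+x_{k+1}-B_ku_k$ for $z=(x,u)$, $k=0,\dots,N-1$;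 $T:W\to\widetilde X$ is $Tw=(T_0w_0,\dots,T_{N-1}w_{N-1})$. Stars on operators denote adjoints, stars on spaces denote topological duals, and the dual of a product is identified with the product of the duals. For a convex set $D$ in a Banach space $Y$ and $\bar y\in D$, $N(\bar y;D)=\{y^*\in Y^*\mid\langle y^*,y-\bar y\rangle\le0\ \forall y\in D\}$. For a convex function $\varphi:Y\to[-\infty,+\infty]$ finite at $\bar y$, $\partial\varphi(\bar y)=\{y^*\in Y^*\mid\langle y^*,y-\bar y\rangle\le\varphi(y)-\varphi(\bar y)\ \forall y\in Y\}$. The symbols $\partial_{x_k}h_k(\bar x_k,\bar u_k,\bar w_k)$, $\partial_{u_k}h_k(\bar x_k,\bar u_k,\bar w_k)$, $\partial_{w_k}h_k(\bar x_k,\bar u_k,\bar w_k)$ denote the subdifferentials of $h_k(\cdot,\bar u_k,\bar w_k)$ at $\bar x_k$, of $h_k(\bar x_k,\cdot,\bar w_k)$ at $\bar u_k$, and of $h_k(\bar x_k,\bar u_k,\cdot)$ at $\bar w_k$, respectively. *)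

theory Defs
  imports "HOL-Analysis.Analysis" "HOL-Library.Function_Algebras"
begin

text \<open>
  A Banach space is rendered as a linear subspace of a real normed vector space that is
  complete in the inherited norm. The ambient type need not be complete. This makes it
  possible to speak of a family \<open>X 0, \<dots>, X N\<close> of different Banach spaces with \<open>N\<close> variable;
  every finite family of Banach spaces arises in this way up to isometry, since its members
  embed into their direct sum.
\<close>

definition banach_subspace :: "'a::real_normed_vector set \<Rightarrow> bool" where
  "banach_subspace V \<longleftrightarrow> subspace V \<and> complete V"

definition continuous_linear_on ::
    "'a::real_normed_vector set \<Rightarrow> 'b::real_normed_vector set \<Rightarrow> ('a \<Rightarrow> 'b) \<Rightarrow> bool" where
  "continuous_linear_on V V' f \<longleftrightarrow>
     f \<in> V \<rightarrow> V' \<and>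
     (\<forall>x\<in>V. \<forall>y\<in>V. f (x + y) = f x + f y) \<and>
     (\<forall>c. \<forall>x\<in>V. f (c *\<^sub>R x) = c *\<^sub>R f x) \<and>
     continuous_on V f"

text \<open>
  Functionals on \<open>V\<close> are normalised to be zero outside \<open>V\<close>, so that equality of functions is
  equality of functionals and the pointwise operations on functions are those of the dual.
\<close>

definition dual_space :: "'a::real_normed_vector set \<Rightarrow> ('a \<Rightarrow> real) set" where
  "dual_space V = {f. continuous_linear_on V UNIV f \<and> (\<forall>x. x \<notin> V \<longrightarrow> f x = 0)}"

text \<open>
  The adjoint of an operator \<open>L\<close> with domain \<open>V\<close>, applied to a functional \<open>y\<close>. The
  domain may also be a product of spaces.
\<close>

definition adjoint_op :: "'p set \<Rightarrow> ('p \<Rightarrow> 'q) \<Rightarrow> ('q \<Rightarrow> real) \<Rightarrow> 'p \<Rightarrow> real" where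
  "adjoint_op V L y = (\<lambda>v. if v \<in> V then y (L v) else 0)"

definition normal_cone :: "'a::real_normed_vector set \<Rightarrow> 'a set \<Rightarrow> 'a \<Rightarrow> ('a \<Rightarrow> real) set" where
  "normal_cone V D yb = {ys \<in> dual_space V. \<forall>y\<in>D. ys (y - yb) \<le> 0}"

definition subdifferential ::
    "'a::real_normed_vector set \<Rightarrow> ('a \<Rightarrow> ereal) \<Rightarrow> 'a \<Rightarrow> ('a \<Rightarrow> real) set" where
  "subdifferential V \<phi> yb =
     {ys \<in> dual_space V. \<forall>y\<in>V. ereal (ys (y - yb)) \<le> \<phi> y - \<phi> yb}"

text \<open>
  The product of spaces \<open>V i\<close>, \<open>i \<in> I\<close>, is \<^term>\<open>PiE I V\<close>. Its dual is identified with the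
  product of the duals: a family \<open>ys\<close> acts on the product as \<open>pairing I ys\<close>.
\<close>

definition pairing :: "'i set \<Rightarrow> ('i \<Rightarrow> 'a \<Rightarrow> real) \<Rightarrow> ('i \<Rightarrow> 'a) \<Rightarrow> real" where
  "pairing I ys y = (\<Sum>i\<in>I. ys i (y i))"

definition dual_prod ::
    "'i set \<Rightarrow> ('i \<Rightarrow> 'a::real_normed_vector set) \<Rightarrow> ('i \<Rightarrow> 'a \<Rightarrow> real) set" where
  "dual_prod I V = (\<Pi>\<^sub>E i\<in>I. dual_space (V i))"

definition normal_cone_prod ::
    "'i set \<Rightarrow> ('i \<Rightarrow> 'a::real_normed_vector set) \<Rightarrow> ('i \<Rightarrow> 'a) set \<Rightarrow> ('i \<Rightarrow> 'a)
      \<Rightarrow> ('i \<Rightarrow> 'a \<Rightarrow> real) set" where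
  "normal_cone_prod I V D yb =
     {ys \<in> dual_prod I V. \<forall>y\<in>D. pairing I ys (\<lambda>i. y i - yb i) \<le> 0}"

definition subdifferential_prod ::
    "'i set \<Rightarrow> ('i \<Rightarrow> 'a::real_normed_vector set) \<Rightarrow> (('i \<Rightarrow> 'a) \<Rightarrow> ereal) \<Rightarrow> ('i \<Rightarrow> 'a)
      \<Rightarrow> ('i \<Rightarrow> 'a \<Rightarrow> real) set" where
  "subdifferential_prod I V \<phi> yb =
     {ys \<in> dual_prod I V. \<forall>y\<in>PiE I V. ereal (pairing I ys (\<lambda>i. y i - yb i)) \<le> \<phi> y - \<phi> yb}"

definition ker_adjoint_prod ::
    "'p set \<Rightarrow> 'i set \<Rightarrow> ('i \<Rightarrow> 'a::real_normed_vector set) \<Rightarrow> ('p \<Rightarrow> 'i \<Rightarrow> 'a)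
      \<Rightarrow> ('i \<Rightarrow> 'a \<Rightarrow> real) set" where
  "ker_adjoint_prod P I V L = {ys \<in> dual_prod I V. adjoint_op P L (pairing I ys) = 0}"

definition cost ::
    "nat \<Rightarrow> (nat \<Rightarrow> 'x \<times> 'u \<times> 'w \<Rightarrow> real) \<Rightarrow> ('x \<Rightarrow> real)
      \<Rightarrow> (nat \<Rightarrow> 'x) \<times> (nat \<Rightarrow> 'u) \<Rightarrow> (nat \<Rightarrow> 'w) \<Rightarrow> real" where
  "cost N h hN = (\<lambda>(x, u) w. (\<Sum>k<N. h k (x k, u k, w k)) + hN (x N))"

definition feasible ::
    "nat \<Rightarrow> (nat \<Rightarrow> 'x::real_normed_vector set) \<Rightarrow> (nat \<Rightarrow> 'u::real_normed_vector set)
      \<Rightarrow> 'x set \<Rightarrow> (nat \<Rightarrow> 'u set)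
      \<Rightarrow> (nat \<Rightarrow> 'x \<Rightarrow> 'x) \<Rightarrow> (nat \<Rightarrow> 'u \<Rightarrow> 'x) \<Rightarrow> (nat \<Rightarrow> 'w \<Rightarrow> 'x)
      \<Rightarrow> (nat \<Rightarrow> 'w) \<Rightarrow> ((nat \<Rightarrow> 'x) \<times> (nat \<Rightarrow> 'u)) set" where
  "feasible N X U C \<Omega> A B T w =
     {(x, u). x \<in> PiE {..N} X \<and> u \<in> PiE {..<N} U \<and>
       (\<forall>k<N. x (Suc k) = A k (x k) + B k (u k) + T k (w k)) \<and>
       (\<forall>k<N. u k \<in> \<Omega> k) \<and> x 0 \<in> C}"

definition opt_value ::
    "nat \<Rightarrow> (nat \<Rightarrow> 'x::real_normed_vector set) \<Rightarrow> (nat \<Rightarrow> 'u::real_normed_vector set)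
      \<Rightarrow> 'x set \<Rightarrow> (nat \<Rightarrow> 'u set)
      \<Rightarrow> (nat \<Rightarrow> 'x \<Rightarrow> 'x) \<Rightarrow> (nat \<Rightarrow> 'u \<Rightarrow> 'x) \<Rightarrow> (nat \<Rightarrow> 'w \<Rightarrow> 'x)
      \<Rightarrow> (nat \<Rightarrow> 'x \<times> 'u \<times> 'w \<Rightarrow> real) \<Rightarrow> ('x \<Rightarrow> real)
      \<Rightarrow> (nat \<Rightarrow> 'w) \<Rightarrow> ereal" where
  "opt_value N X U C \<Omega> A B T h hN w =
     (INF z\<in>feasible N X U C \<Omega> A B T w. ereal (cost N h hN z w))"

definition solutions ::
    "nat \<Rightarrow> (nat \<Rightarrow> 'x::real_normed_vector set) \<Rightarrow> (nat \<Rightarrow> 'u::real_normed_vector set)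
      \<Rightarrow> 'x set \<Rightarrow> (nat \<Rightarrow> 'u set)
      \<Rightarrow> (nat \<Rightarrow> 'x \<Rightarrow> 'x) \<Rightarrow> (nat \<Rightarrow> 'u \<Rightarrow> 'x) \<Rightarrow> (nat \<Rightarrow> 'w \<Rightarrow> 'x)
      \<Rightarrow> (nat \<Rightarrow> 'x \<times> 'u \<times> 'w \<Rightarrow> real) \<Rightarrow> ('x \<Rightarrow> real)
      \<Rightarrow> (nat \<Rightarrow> 'w) \<Rightarrow> ((nat \<Rightarrow> 'x) \<times> (nat \<Rightarrow> 'u)) set" where
  "solutions N X U C \<Omega> A B T h hN w =
     {z \<in> feasible N X U C \<Omega> A B T w.
       \<forall>z'\<in>feasible N X U C \<Omega> A B T w. cost N h hN z w \<le> cost N h hN z' w}"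

text \<open>
  Elements of \<open>X 1 \<times> \<dots> \<times> X N\<close> are indexed by \<open>j \<in> {1..N}\<close>, so the component of index \<open>j\<close> below
  is the one usually written with \<open>j = k + 1\<close>.
\<close>

definition M_op ::
    "nat \<Rightarrow> (nat \<Rightarrow> 'x \<Rightarrow> 'x) \<Rightarrow> (nat \<Rightarrow> 'u \<Rightarrow> 'x)
      \<Rightarrow> (nat \<Rightarrow> 'x::real_normed_vector) \<times> (nat \<Rightarrow> 'u) \<Rightarrow> nat \<Rightarrow> 'x" where
  "M_op N A B = (\<lambda>(x, u). \<lambda>j\<in>{1..N}. - A (j - 1) (x (j - 1)) + x j - B (j - 1) (u (j - 1)))"

definition T_op :: "nat \<Rightarrow> (nat \<Rightarrow> 'w \<Rightarrow> 'x) \<Rightarrow> (nat \<Rightarrow> 'w) \<Rightarrow> nat \<Rightarrow> 'x" where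
  "T_op N T w = (\<lambda>j\<in>{1..N}. T (j - 1) (w (j - 1)))"

definition Phi_op ::
    "nat \<Rightarrow> (nat \<Rightarrow> 'x \<Rightarrow> 'x) \<Rightarrow> (nat \<Rightarrow> 'u \<Rightarrow> 'x) \<Rightarrow> (nat \<Rightarrow> 'w \<Rightarrow> 'x)
      \<Rightarrow> (nat \<Rightarrow> 'w) \<times> (nat \<Rightarrow> 'x::real_normed_vector) \<times> (nat \<Rightarrow> 'u) \<Rightarrow> nat \<Rightarrow> 'x" where
  "Phi_op N A B T = (\<lambda>(w, z). \<lambda>j\<in>{1..N}. - T_op N T w j + M_op N A B z j)"

end

theory Submission
  imports Defs
begin

text \<open>
  A subgradient \<open>ws\<close> of the optimal value function at \<open>wb\<close> turns \<open>(xb, ub, wb)\<close> into a minimizer of the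
  cost minus \<open>ws\<close> over all \<open>(x, u, w)\<close> that satisfy the dynamics, \<open>x 0 \<in> C\<close> and \<open>u k \<in> \<Omega> k\<close>
  (\<open>opt_value_subgradient_inequality\<close>). The parameter is now a variable of a convex problem, and the
  theorem is the multiplier rule for this problem.

  Minimality says that the linear function \<open>g\<close> given by \<open>ws\<close> lies below the increase of the cost on the
  convex set \<open>D\<close> of feasible perturbations. The cost is convex and finite on the whole space, so the two
  can be separated by a linear functional, and the functional splits along the stages: the sandwich theorem
  (\<open>sandwich\<close>, \<open>sandwich_sum\<close>) yields linear functionals \<open>\<xi> k\<close>, below the increases of the stage costs, whose sum
  still dominates \<open>g\<close> on \<open>D\<close>. They are continuous because they lie below continuous functions
  (\<open>linear_minorant_continuous\<close>), so each \<open>\<xi> k\<close> is a subgradient of a stage cost, and its three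
  components \<open>a k\<close>, \<open>b k\<close>, \<open>c k\<close> are partial subgradients. The sandwich theorem rests on the
  Hahn-Banach theorem, proved in the form that every convex function on a subspace which vanishes at
  \<open>0\<close> has a linear minorant (\<open>convex_linear_minorant\<close>).

  What remains is linear algebra. Initial state, controls and parameters can be varied
  independently and determine the trajectory. The costate defined by \<open>p N = a N\<close> and
  \<open>p k = a k + (A k)\<^sup>* (p (k + 1))\<close> eliminates the states (\<open>costate_pairing\<close>), and the domination of \<open>g\<close> becomes
  the inequality
  \<open>\<Sum>k. ws k (dw k) \<le> p 0 (dx 0) + (\<Sum>k. (b k + (B k)\<^sup>* (p (k + 1))) (du k)) + (\<Sum>k. (c k + (T k)\<^sup>* (p (k + 1))) (dw k))\<close>.
  Varying only \<open>dx 0\<close> puts \<open>- p 0\<close> into the normal cone of \<open>C\<close>, varying only \<open>du\<close> puts the family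
  \<open>- b k - (B k)\<^sup>* (p (k + 1))\<close> into the normal cone of the product of the \<open>\<Omega> k\<close>, and varying only \<open>dw\<close>, which is
  unconstrained, identifies \<open>ws k\<close> with \<open>c k + (T k)\<^sup>* (p (k + 1))\<close>. The multipliers are \<open>p 1, \<dots>, p N\<close>.
\<close>

section \<open>Linear minorants of convex functions and the sandwich theorem\<close>

definition linear_functional_on :: "'a::real_vector set \<Rightarrow> ('a \<Rightarrow> real) \<Rightarrow> bool" where
  "linear_functional_on S \<xi> \<longleftrightarrow>
     (\<forall>x\<in>S. \<forall>y\<in>S. \<xi> (x + y) = \<xi> x + \<xi> y) \<and> (\<forall>c. \<forall>x\<in>S. \<xi> (c *\<^sub>R x) = c * \<xi> x)"

lemma convex_on_combination:
  assumes "convex_on S f" "x \<in> S" "y \<in> S" "0 \<le> u" "0 \<le> v" "u + v = 1"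
  shows "f (u *\<^sub>R x + v *\<^sub>R y) \<le> u * f x + v * f y"
  using assms unfolding convex_on_def by blast

lemma linear_functional_on_zero:
  assumes "linear_functional_on S \<xi>" "subspace S"
  shows "\<xi> 0 = 0"
  using assms unfolding linear_functional_on_def
  by (metis mult_zero_left scaleR_zero_left subspace_0)

lemma linear_functional_on_minus:
  assumes "linear_functional_on S \<xi>" "x \<in> S"
  shows "\<xi> (- x) = - \<xi> x"
proof -
  have "\<xi> ((-1) *\<^sub>R x) = (-1) * \<xi> x"
    using assms unfolding linear_functional_on_def by blast
  then show ?thesis by simp
qed

lemma linear_functional_on_convex:
  assumes "linear_functional_on S \<xi>" "subspace S"
  shows "convex_on S \<xi>"
  using assms unfolding linear_functional_on_def convex_on_def
  by (auto simp: subspace_imp_convex subspace_scale)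

text \<open>
  \<open>\<phi> x = inf {f (x + e) - r | (e, r) \<in> K}\<close> does the job; it is an infimal convolution of \<open>f\<close> with
  the reflected set \<open>K\<close>. The point is that the infimum is finite: since \<open>K\<close> contains the segment
  from \<open>(0, 0)\<close> to \<open>(e, r)\<close>, the midpoint satisfies \<open>r / 2 \<le> f (e / 2)\<close>, and \<open>e / 2\<close> is the midpoint
  of \<open>x + e\<close> and \<open>- x\<close>, so convexity gives \<open>- f (- x) \<le> f (x + e) - r\<close>. The gain over
  \<open>f\<close> is that \<open>\<phi> (- e) \<le> - r\<close>: it makes minimal convex functions odd, and it forces a linear minorant
  of \<open>\<phi>\<close> to be at least \<open>r\<close> at \<open>e\<close>.
\<close>

lemma convex_infimal_translate:
  fixes f :: "'a::real_vector \<Rightarrow> real"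
  assumes S: "subspace S" and f: "convex_on S f" "f 0 = 0"
    and K: "convex K" "K \<subseteq> S \<times> UNIV" "(0, 0) \<in> K"
    and Kf: "\<And>e r. (e, r) \<in> K \<Longrightarrow> r \<le> f e"
  obtains \<phi> where "convex_on S \<phi>" "\<phi> 0 = 0"
    "\<And>x e r. x \<in> S \<Longrightarrow> (e, r) \<in> K \<Longrightarrow> \<phi> x \<le> f (x + e) - r"
proof -
  define Q where "Q x = (\<lambda>(e, r). f (x + e) - r) ` K" for x
  define \<phi> where "\<phi> x = Inf (Q x)" for x
  have lower: "- f (- x) \<le> f (x + e) - r" if x: "x \<in> S" and er: "(e, r) \<in> K" for x e r
  proof -
    have e: "e \<in> S" using er K by auto
    have "(1/2) *\<^sub>R (e, r) + (1/2) *\<^sub>R (0, 0) \<in> K"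
      using K er by (intro convexD) auto
    then have "((1/2) *\<^sub>R e, r / 2) \<in> K" by simp
    then have "r / 2 \<le> f ((1/2) *\<^sub>R e)" by (rule Kf)
    also have "(1/2) *\<^sub>R e = (1/2) *\<^sub>R (x + e) + (1/2) *\<^sub>R (- x)"
      by (simp add: algebra_simps)
    also have "f \<dots> \<le> (1/2) * f (x + e) + (1/2) * f (- x)"
      using S x e by (intro convex_on_combination[OF f(1)]) (auto intro: subspace_add subspace_neg)
    finally show ?thesis by simp
  qed
  have bdd: "bdd_below (Q x)" if "x \<in> S" for x
    using lower[OF that] unfolding Q_def by (intro bdd_belowI[where m = "- f (- x)"]) auto
  have ne: "Q x \<noteq> {}" for x using K unfolding Q_def by auto
  have upper: "\<phi> x \<le> f (x + e) - r" if "x \<in> S" "(e, r) \<in> K" for x e r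
    unfolding \<phi>_def using bdd[OF that(1)] that(2) by (intro cInf_lower) (force simp: Q_def)+
  have approx: "\<exists>e r. (e, r) \<in> K \<and> f (x + e) - r < \<phi> x + \<epsilon>" if "\<epsilon> > 0" for x \<epsilon>
  proof -
    have "Inf (Q x) < \<phi> x + \<epsilon>" using that by (simp add: \<phi>_def)
    from cInf_lessD[OF ne this] show ?thesis unfolding Q_def by auto
  qed
  have "convex_on S \<phi>"
    unfolding convex_on_def
  proof (intro conjI ballI allI impI)
    show "convex S" using S by (rule subspace_imp_convex)
    fix x y and u v :: real assume x: "x \<in> S" and y: "y \<in> S" and uv: "0 \<le> u" "0 \<le> v" "u + v = 1"
    show "\<phi> (u *\<^sub>R x + v *\<^sub>R y) \<le> u * \<phi> x + v * \<phi> y"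
    proof (rule field_le_epsilon)
      fix \<epsilon> :: real assume "\<epsilon> > 0"
      obtain e r where er: "(e, r) \<in> K" "f (x + e) - r < \<phi> x + \<epsilon>" using approx[OF \<open>\<epsilon> > 0\<close>] by blast
      obtain e' r' where er': "(e', r') \<in> K" "f (y + e') - r' < \<phi> y + \<epsilon>"
        using approx[OF \<open>\<epsilon> > 0\<close>] by blast
      have S': "e \<in> S" "e' \<in> S" using er er' K by auto
      have "u *\<^sub>R (e, r) + v *\<^sub>R (e', r') \<in> K"
        using K er er' uv by (intro convexD) auto
      then have "(u *\<^sub>R e + v *\<^sub>R e', u * r + v * r') \<in> K" by simp
      moreover have "u *\<^sub>R x + v *\<^sub>R y \<in> S" using S x y by (intro subspace_add subspace_scale)
      ultimately have "\<phi> (u *\<^sub>R x + v *\<^sub>R y)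
          \<le> f ((u *\<^sub>R x + v *\<^sub>R y) + (u *\<^sub>R e + v *\<^sub>R e')) - (u * r + v * r')"
        by (intro upper)
      also have "(u *\<^sub>R x + v *\<^sub>R y) + (u *\<^sub>R e + v *\<^sub>R e') = u *\<^sub>R (x + e) + v *\<^sub>R (y + e')"
        by (simp add: algebra_simps)
      also have "f \<dots> \<le> u * f (x + e) + v * f (y + e')"
        using S x y S' uv by (intro convex_on_combination[OF f(1)]) (auto intro: subspace_add)
      also have "u * f (x + e) + v * f (y + e') - (u * r + v * r')
          = u * (f (x + e) - r) + v * (f (y + e') - r')"
        by (simp add: algebra_simps)
      also have "\<dots> \<le> u * (\<phi> x + \<epsilon>) + v * (\<phi> y + \<epsilon>)"
        using er er' uv by (intro add_mono mult_left_mono) auto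
      also have "\<dots> = u * \<phi> x + v * \<phi> y + (u + v) * \<epsilon>" by (simp add: algebra_simps)
      finally show "\<phi> (u *\<^sub>R x + v *\<^sub>R y) \<le> u * \<phi> x + v * \<phi> y + \<epsilon>" using uv by simp
    qed
  qed
  moreover have "\<phi> 0 = 0"
  proof (rule antisym)
    show "\<phi> 0 \<le> 0" using upper[OF subspace_0[OF S] K(3)] f by simp
    show "0 \<le> \<phi> 0" unfolding \<phi>_def
      using ne lower[OF subspace_0[OF S]] f by (intro cInf_greatest) (auto simp: Q_def)
  qed
  ultimately show ?thesis using upper that by blast
qed

text \<open>
  Zorn's lemma, applied to the convex functions below \<open>f\<close> that vanish at \<open>0\<close>. All of them are bounded
  below at \<open>x\<close> by \<open>- f (- x)\<close>, and along a chain the pointwise infimum stays convex, because near-optimal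
  functions for two different points can be replaced by the smaller of the two. Functions are cut off
  to \<open>0\<close> outside \<open>S\<close> to make the pointwise order antisymmetric.
\<close>

lemma minimal_convex_minorant:
  fixes f :: "'a::real_vector \<Rightarrow> real"
  assumes S: "subspace S" and f: "convex_on S f" "f 0 = 0"
  obtains m where "convex_on S m" "m 0 = 0" "\<And>x. x \<in> S \<Longrightarrow> m x \<le> f x"
    "\<And>\<psi> x. convex_on S \<psi> \<Longrightarrow> \<psi> 0 = 0 \<Longrightarrow> (\<And>y. y \<in> S \<Longrightarrow> \<psi> y \<le> m y) \<Longrightarrow> x \<in> S \<Longrightarrow> \<psi> x = m x"
proof -
  define P where "P = {\<phi>. convex_on S \<phi> \<and> \<phi> 0 = 0 \<and> (\<forall>x\<in>S. \<phi> x \<le> f x) \<and> (\<forall>x. x \<notin> S \<longrightarrow> \<phi> x = 0)}"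
  define R where "R \<phi> \<psi> \<longleftrightarrow> (\<forall>x. \<psi> x \<le> \<phi> x)" for \<phi> \<psi> :: "'a \<Rightarrow> real"
  have cut: "convex_on S (\<lambda>x. if x \<in> S then \<phi> x else 0)" if "convex_on S \<phi>" for \<phi>
    using that S unfolding convex_on_def by (auto simp: subspace_add subspace_scale)
  have cutP: "(\<lambda>x. if x \<in> S then \<phi> x else 0) \<in> P"
    if "convex_on S \<phi>" "\<phi> 0 = 0" "\<And>x. x \<in> S \<Longrightarrow> \<phi> x \<le> f x" for \<phi>
    using that cut[OF that(1)] unfolding P_def by auto
  have lower: "- f (- x) \<le> \<phi> x" if \<phi>: "\<phi> \<in> P" and x: "x \<in> S" for \<phi> x
  proof -
    have mx: "- x \<in> S" using S x by (rule subspace_neg)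
    have c: "convex_on S \<phi>" and z: "\<phi> 0 = 0" and le: "\<phi> (- x) \<le> f (- x)"
      using \<phi> mx unfolding P_def by auto
    have "\<phi> ((1/2) *\<^sub>R x + (1/2) *\<^sub>R (- x)) \<le> (1/2) * \<phi> x + (1/2) * \<phi> (- x)"
      using x mx by (intro convex_on_combination[OF c]) auto
    then show ?thesis using z le by simp
  qed
  have "\<exists>m\<in>P. \<forall>\<phi>\<in>P. R m \<phi> \<longrightarrow> \<phi> = m"
  proof (rule predicate_Zorn)
    show "partial_order_on P (relation_of R P)"
      by (rule partial_order_on_relation_ofI) (auto simp: R_def fun_eq_iff intro: antisym order_trans)
  next
    fix \<C> assume "\<C> \<in> Chains (relation_of R P)"
    then have sub: "\<C> \<subseteq> P" and tot: "\<And>\<phi> \<psi>. \<phi> \<in> \<C> \<Longrightarrow> \<psi> \<in> \<C> \<Longrightarrow> R \<phi> \<psi> \<or> R \<psi> \<phi>"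
      unfolding Chains_def relation_of_def by auto
    show "\<exists>\<psi>\<in>P. \<forall>\<phi>\<in>\<C>. R \<phi> \<psi>"
    proof (cases "\<C> = {}")
      case True
      then show ?thesis using cutP[OF f] by auto
    next
      case ne: False
      define \<psi> where "\<psi> x = (INF \<phi>\<in>\<C>. \<phi> x)" for x
      have bdd: "bdd_below ((\<lambda>\<phi>. \<phi> x) ` \<C>)" if "x \<in> S" for x
        using lower sub that by (intro bdd_belowI[where m = "- f (- x)"]) auto
      have upper: "\<psi> x \<le> \<phi> x" if "x \<in> S" "\<phi> \<in> \<C>" for x \<phi>
        unfolding \<psi>_def using bdd that by (intro cINF_lower) auto
      have approx: "\<exists>\<phi>\<in>\<C>. \<phi> x < \<psi> x + \<epsilon>" if "\<epsilon> > 0" for x \<epsilon>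
      proof -
        have "Inf ((\<lambda>\<phi>. \<phi> x) ` \<C>) < \<psi> x + \<epsilon>" using that by (simp add: \<psi>_def)
        from cInf_lessD[OF _ this] ne show ?thesis by auto
      qed
      have "convex_on S \<psi>"
        unfolding convex_on_def
      proof (intro conjI ballI allI impI)
        show "convex S" using S by (rule subspace_imp_convex)
        fix x y and u v :: real assume x: "x \<in> S" and y: "y \<in> S" and uv: "0 \<le> u" "0 \<le> v" "u + v = 1"
        show "\<psi> (u *\<^sub>R x + v *\<^sub>R y) \<le> u * \<psi> x + v * \<psi> y"
        proof (rule field_le_epsilon)
          fix \<epsilon> :: real assume "\<epsilon> > 0"
          obtain \<phi>1 where 1: "\<phi>1 \<in> \<C>" "\<phi>1 x < \<psi> x + \<epsilon>" using approx[OF \<open>\<epsilon> > 0\<close>] by blast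
          obtain \<phi>2 where 2: "\<phi>2 \<in> \<C>" "\<phi>2 y < \<psi> y + \<epsilon>" using approx[OF \<open>\<epsilon> > 0\<close>] by blast
          obtain \<phi> where \<phi>: "\<phi> \<in> \<C>" "\<phi> x < \<psi> x + \<epsilon>" "\<phi> y < \<psi> y + \<epsilon>"
          proof (cases "R \<phi>1 \<phi>2")
            case True
            then have "\<phi>2 x \<le> \<phi>1 x" unfolding R_def by blast
            then show ?thesis using 1 2 that[of \<phi>2] by linarith
          next
            case False
            then have "\<phi>1 y \<le> \<phi>2 y" using tot 1 2 unfolding R_def by blast
            then show ?thesis using 1 2 that[of \<phi>1] by linarith
          qed
          have "u *\<^sub>R x + v *\<^sub>R y \<in> S" using S x y by (intro subspace_add subspace_scale)
          then have "\<psi> (u *\<^sub>R x + v *\<^sub>R y) \<le> \<phi> (u *\<^sub>R x + v *\<^sub>R y)" using upper \<phi> by blast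
          also have "\<dots> \<le> u * \<phi> x + v * \<phi> y"
            using \<phi> sub x y uv unfolding P_def by (intro convex_on_combination) auto
          also have "\<dots> \<le> u * (\<psi> x + \<epsilon>) + v * (\<psi> y + \<epsilon>)"
            using \<phi> uv by (intro add_mono mult_left_mono) auto
          also have "\<dots> = u * \<psi> x + v * \<psi> y + (u + v) * \<epsilon>" by (simp add: algebra_simps)
          finally show "\<psi> (u *\<^sub>R x + v *\<^sub>R y) \<le> u * \<psi> x + v * \<psi> y + \<epsilon>" using uv by simp
        qed
      qed
      moreover have "\<psi> 0 = 0"
      proof -
        have "(\<lambda>\<phi>. \<phi> 0) ` \<C> = {0}" using ne sub unfolding P_def by auto
        then show ?thesis unfolding \<psi>_def by simp
      qed
      moreover have "\<psi> x \<le> f x" if "x \<in> S" for x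
      proof -
        obtain \<phi> where "\<phi> \<in> \<C>" using ne by blast
        then show ?thesis using upper[OF that] sub that unfolding P_def by fastforce
      qed
      ultimately have "(\<lambda>x. if x \<in> S then \<psi> x else 0) \<in> P" by (rule cutP)
      moreover have "R \<phi> (\<lambda>x. if x \<in> S then \<psi> x else 0)" if "\<phi> \<in> \<C>" for \<phi>
        using upper that sub unfolding R_def P_def by auto
      ultimately show ?thesis by blast
    qed
  qed
  then obtain m where m: "m \<in> P" and min: "\<And>\<phi>. \<phi> \<in> P \<Longrightarrow> R m \<phi> \<Longrightarrow> \<phi> = m" by blast
  show ?thesis
  proof
    show "convex_on S m" "m 0 = 0" "\<And>x. x \<in> S \<Longrightarrow> m x \<le> f x" using m unfolding P_def by auto
    fix \<psi> x assume \<psi>: "convex_on S \<psi>" "\<psi> 0 = 0" "\<And>y. y \<in> S \<Longrightarrow> \<psi> y \<le> m y" and x: "x \<in> S"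
    have "\<psi> y \<le> f y" if "y \<in> S" for y using \<psi>(3)[OF that] m that unfolding P_def by force
    then have "(\<lambda>x. if x \<in> S then \<psi> x else 0) \<in> P" using \<psi> by (intro cutP)
    moreover have "R m (\<lambda>x. if x \<in> S then \<psi> x else 0)"
      using \<psi>(3) m unfolding R_def P_def by auto
    ultimately have "(\<lambda>x. if x \<in> S then \<psi> x else 0) = m" by (rule min)
    from fun_cong[OF this, of x] show "\<psi> x = m x" using x by simp
  qed
qed

text \<open>
  The Hahn-Banach theorem in the form "a convex function has an algebraic subgradient". A minimal
  convex minorant \<open>m\<close> is already linear. For \<open>0 < t \<le> 1\<close> the function \<open>x \<mapsto> m (t x) / t\<close> is a competitor
  lying below \<open>m\<close>, so minimality forces positive homogeneity, hence subadditivity. Translating along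
  the ray through \<open>v\<close>, as in \<open>convex_infimal_translate\<close>, gives a competitor whose value at \<open>- v\<close> is
  at most \<open>- m v\<close>, so \<open>m\<close> is odd; a sublinear odd function is linear.
\<close>

lemma convex_linear_minorant:
  fixes f :: "'a::real_vector \<Rightarrow> real"
  assumes S: "subspace S" and f: "convex_on S f" "f 0 = 0"
  obtains \<xi> where "linear_functional_on S \<xi>" "\<And>x. x \<in> S \<Longrightarrow> \<xi> x \<le> f x"
proof -
  obtain m where m: "convex_on S m" "m 0 = 0" and mf: "\<And>x. x \<in> S \<Longrightarrow> m x \<le> f x"
    and min: "\<And>\<psi> x. convex_on S \<psi> \<Longrightarrow> \<psi> 0 = 0 \<Longrightarrow> (\<And>y. y \<in> S \<Longrightarrow> \<psi> y \<le> m y) \<Longrightarrow> x \<in> S \<Longrightarrow> \<psi> x = m x"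
    using minimal_convex_minorant[OF assms] by blast
  have scale1: "m (t *\<^sub>R x) = t * m x" if t: "0 < t" "t \<le> 1" and x: "x \<in> S" for t x
  proof -
    let ?\<psi> = "\<lambda>y. m (t *\<^sub>R y) / t"
    have "convex_on S ?\<psi>"
      unfolding convex_on_def
    proof (intro conjI ballI allI impI)
      show "convex S" using S by (rule subspace_imp_convex)
      fix y z and u v :: real assume y: "y \<in> S" and z: "z \<in> S" and uv: "0 \<le> u" "0 \<le> v" "u + v = 1"
      have "m (u *\<^sub>R (t *\<^sub>R y) + v *\<^sub>R (t *\<^sub>R z)) \<le> u * m (t *\<^sub>R y) + v * m (t *\<^sub>R z)"
        using S y z uv by (intro convex_on_combination[OF m(1)] subspace_scale)
      also have "u *\<^sub>R (t *\<^sub>R y) + v *\<^sub>R (t *\<^sub>R z) = t *\<^sub>R (u *\<^sub>R y + v *\<^sub>R z)"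
        by (simp add: algebra_simps)
      finally show "?\<psi> (u *\<^sub>R y + v *\<^sub>R z) \<le> u * ?\<psi> y + v * ?\<psi> z"
        using t by (simp add: field_simps)
    qed
    moreover have "?\<psi> y \<le> m y" if y: "y \<in> S" for y
    proof -
      have "m (t *\<^sub>R y + (1 - t) *\<^sub>R 0) \<le> t * m y + (1 - t) * m 0"
        using t y S by (intro convex_on_combination[OF m(1)]) (auto intro: subspace_0)
      then show ?thesis using t m by (simp add: field_simps)
    qed
    ultimately have "?\<psi> x = m x" using x m by (intro min) auto
    then show ?thesis using t by (simp add: field_simps)
  qed
  have scale: "m (t *\<^sub>R x) = t * m x" if t: "0 < t" and x: "x \<in> S" for t x
  proof (cases "t \<le> 1")
    case False
    then have "m ((1 / t) *\<^sub>R (t *\<^sub>R x)) = (1 / t) * m (t *\<^sub>R x)"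
      using S x by (intro scale1 subspace_scale) auto
    then show ?thesis using t by (simp add: field_simps)
  qed (use scale1 that in blast)
  have subadd: "m (x + y) \<le> m x + m y" if x: "x \<in> S" and y: "y \<in> S" for x y
  proof -
    have "m ((1/2) *\<^sub>R (x + y)) = (1/2) * m (x + y)"
      using S x y by (intro scale) (auto intro: subspace_add)
    moreover have "m ((1/2) *\<^sub>R x + (1/2) *\<^sub>R y) \<le> (1/2) * m x + (1/2) * m y"
      using x y by (intro convex_on_combination[OF m(1)]) auto
    ultimately show ?thesis by (simp add: scaleR_add_right)
  qed
  have odd: "m (- v) = - m v" if v: "v \<in> S" for v
  proof -
    \<comment> \<open>The ray from the origin through \<open>(v, m v)\<close>; it lies on the graph of \<open>m\<close> by homogeneity.\<close>
    let ?K = "(\<lambda>s. (s *\<^sub>R v, s * m v)) ` {0..}"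
    have "convex ?K"
    proof (rule convexI)
      fix a b and u w :: real assume "a \<in> ?K" "b \<in> ?K" and uw: "0 \<le> u" "0 \<le> w" "u + w = 1"
      then obtain s t where st: "0 \<le> s" "0 \<le> t" "a = (s *\<^sub>R v, s * m v)" "b = (t *\<^sub>R v, t * m v)"
        by auto
      have "u *\<^sub>R a + w *\<^sub>R b = ((u * s + w * t) *\<^sub>R v, (u * s + w * t) * m v)"
        using st by (simp add: algebra_simps)
      moreover have "u * s + w * t \<ge> 0" using st uw by simp
      ultimately show "u *\<^sub>R a + w *\<^sub>R b \<in> ?K" by auto
    qed
    moreover have "?K \<subseteq> S \<times> UNIV" using S v by (auto intro: subspace_scale)
    moreover have "(0, 0) \<in> ?K" by (rule image_eqI[where x = 0]) auto
    moreover have "r \<le> m e" if "(e, r) \<in> ?K" for e r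
    proof -
      from that obtain s where "(e, r) = (s *\<^sub>R v, s * m v)" "s \<in> {0..}" by (rule imageE)
      then have "s \<ge> 0" "e = s *\<^sub>R v" "r = s * m v" by simp_all
      then show ?thesis using scale[OF _ v] m(2) by (cases "s = 0") auto
    qed
    ultimately obtain \<psi> where \<psi>: "convex_on S \<psi>" "\<psi> 0 = 0"
      "\<And>x e r. x \<in> S \<Longrightarrow> (e, r) \<in> ?K \<Longrightarrow> \<psi> x \<le> m (x + e) - r"
      using convex_infimal_translate[OF S m, of ?K] by blast
    have mv: "- v \<in> S" using S v by (rule subspace_neg)
    have "\<psi> y \<le> m y" if "y \<in> S" for y using \<psi>(3)[OF that \<open>(0, 0) \<in> ?K\<close>] by simp
    then have "\<psi> (- v) = m (- v)" using \<psi> mv by (intro min)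
    moreover have "(v, m v) \<in> ?K" by (rule image_eqI[where x = 1]) auto
    then have "\<psi> (- v) \<le> m (- v + v) - m v" using \<psi>(3)[OF mv] by blast
    moreover have "m (v + - v) \<le> m v + m (- v)" using v mv by (rule subadd)
    ultimately show ?thesis using m by simp
  qed
  have "linear_functional_on S m"
    unfolding linear_functional_on_def
  proof (intro conjI ballI allI)
    fix x y assume x: "x \<in> S" and y: "y \<in> S"
    have "m ((x + y) + - y) \<le> m (x + y) + m (- y)"
      using S x y by (intro subadd) (auto intro: subspace_add subspace_neg)
    then show "m (x + y) = m x + m y" using subadd[OF x y] odd[OF y] by simp
  next
    fix c :: real and x assume x: "x \<in> S"
    consider "c > 0" | "c = 0" | "- c > 0" by linarith
    then show "m (c *\<^sub>R x) = c * m x"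
    proof cases
      case 3
      then have "m ((- c) *\<^sub>R x) = (- c) * m x" using x by (rule scale)
      moreover have "m (- (c *\<^sub>R x)) = - m (c *\<^sub>R x)" using S x by (intro odd subspace_scale)
      ultimately show ?thesis by simp
    qed (use scale x m in auto)
  qed
  then show ?thesis using mf that by blast
qed

text \<open>
  Separation of the convex set \<open>K\<close> from the epigraph of \<open>f\<close>: think of \<open>K\<close> as the hypograph of a
  concave function on a convex subset of \<open>S\<close>, lying below \<open>f\<close> and touching it at \<open>0\<close>. The linear minorant
  of the infimal translate of \<open>f\<close> along \<open>K\<close> separates the two.
\<close>

lemma sandwich:
  fixes f :: "'a::real_vector \<Rightarrow> real"
  assumes S: "subspace S" and f: "convex_on S f" "f 0 = 0"
    and K: "convex K" "K \<subseteq> S \<times> UNIV" "(0, 0) \<in> K"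
    and Kf: "\<And>e r. (e, r) \<in> K \<Longrightarrow> r \<le> f e"
  obtains \<xi> where "linear_functional_on S \<xi>" "\<And>x. x \<in> S \<Longrightarrow> \<xi> x \<le> f x"
    "\<And>e r. (e, r) \<in> K \<Longrightarrow> r \<le> \<xi> e"
proof -
  obtain \<phi> where \<phi>: "convex_on S \<phi>" "\<phi> 0 = 0"
    and \<phi>_le: "\<And>x e r. x \<in> S \<Longrightarrow> (e, r) \<in> K \<Longrightarrow> \<phi> x \<le> f (x + e) - r"
    using convex_infimal_translate[OF assms] by metis
  obtain \<xi> where \<xi>: "linear_functional_on S \<xi>" and le: "\<And>x. x \<in> S \<Longrightarrow> \<xi> x \<le> \<phi> x"
    using convex_linear_minorant[OF S \<phi>] by metis
  show ?thesis
  proof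
    show "linear_functional_on S \<xi>" by fact
    show "\<xi> x \<le> f x" if "x \<in> S" for x using le[OF that] \<phi>_le[OF that K(3)] by simp
    fix e r assume er: "(e, r) \<in> K"
    then have e: "e \<in> S" using K by auto
    then have "- e \<in> S" using S by (simp add: subspace_neg)
    from le[OF this] \<phi>_le[OF this er] show "r \<le> \<xi> e"
      using f linear_functional_on_minus[OF \<xi> e] by simp
  qed
qed

text \<open>
  The sum rule for subdifferentials, merged with the multiplier rule for the constraint set \<open>D\<close>. The
  summands are replaced by linear minorants one at a time. When the summand \<open>f j\<close> is treated, all
  other summands, already linear or still convex, are moved to the concave side; the sandwich
  theorem is applied on the single space \<open>S j\<close> to the set \<open>K\<close> of all \<open>(d j, r)\<close> with \<open>d \<in> D\<close> and \<open>r\<close> at most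
  the resulting concave function. In this way the product of the spaces \<open>S i\<close> is never needed as a
  vector space of its own.
\<close>

lemma sandwich_sum:
  fixes f :: "'i \<Rightarrow> 'a::real_vector \<Rightarrow> real"
  assumes I: "finite I"
    and S: "\<And>i. i \<in> I \<Longrightarrow> subspace (S i)"
    and f: "\<And>i. i \<in> I \<Longrightarrow> convex_on (S i) (f i)" "\<And>i. i \<in> I \<Longrightarrow> f i 0 = 0"
    and D_sub: "\<And>d i. d \<in> D \<Longrightarrow> i \<in> I \<Longrightarrow> d i \<in> S i"
    and D_convex: "\<And>d e u v. d \<in> D \<Longrightarrow> e \<in> D \<Longrightarrow> 0 \<le> u \<Longrightarrow> 0 \<le> v \<Longrightarrow> u + v = 1
        \<Longrightarrow> (\<lambda>i. u *\<^sub>R d i + v *\<^sub>R e i) \<in> D"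
    and D_zero: "(\<lambda>i. 0) \<in> D" "g (\<lambda>i. 0) = 0"
    and g: "\<And>d e u v. d \<in> D \<Longrightarrow> e \<in> D \<Longrightarrow> 0 \<le> u \<Longrightarrow> 0 \<le> v \<Longrightarrow> u + v = 1
        \<Longrightarrow> u * g d + v * g e \<le> g (\<lambda>i. u *\<^sub>R d i + v *\<^sub>R e i)"
    and gf: "\<And>d. d \<in> D \<Longrightarrow> g d \<le> (\<Sum>i\<in>I. f i (d i))"
  obtains \<xi> where "\<And>i. i \<in> I \<Longrightarrow> linear_functional_on (S i) (\<xi> i)"
    "\<And>i x. i \<in> I \<Longrightarrow> x \<in> S i \<Longrightarrow> \<xi> i x \<le> f i x"
    "\<And>d. d \<in> D \<Longrightarrow> g d \<le> (\<Sum>i\<in>I. \<xi> i (d i))"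
proof -
  have "\<exists>\<xi>. (\<forall>i\<in>J. linear_functional_on (S i) (\<xi> i) \<and> (\<forall>x\<in>S i. \<xi> i x \<le> f i x)) \<and>
          (\<forall>d\<in>D. g d \<le> (\<Sum>i\<in>J. \<xi> i (d i)) + (\<Sum>i\<in>I - J. f i (d i)))"
    if "finite J" "J \<subseteq> I" for J
    using that
  proof (induction J rule: finite_induct)
    case empty
    then show ?case using gf by auto
  next
    case (insert j J)
    have "J \<subseteq> I" using insert.prems by simp
    from insert.IH[OF this] obtain \<xi> where \<xi>: "\<And>i. i \<in> J \<Longrightarrow> linear_functional_on (S i) (\<xi> i)"
      and \<xi>f: "\<And>i x. i \<in> J \<Longrightarrow> x \<in> S i \<Longrightarrow> \<xi> i x \<le> f i x"
      and g\<xi>: "\<And>d. d \<in> D \<Longrightarrow> g d \<le> (\<Sum>i\<in>J. \<xi> i (d i)) + (\<Sum>i\<in>I - J. f i (d i))"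
      by blast
    have j: "j \<in> I" "j \<notin> J" and J: "J \<subseteq> I" using insert by auto
    \<comment> \<open>The summands at the present stage: linear on \<open>J\<close>, the given convex ones elsewhere.\<close>
    define \<phi> where "\<phi> i = (if i \<in> J then \<xi> i else f i)" for i
    define I' where "I' = I - {j}"
    have \<phi>_convex: "convex_on (S i) (\<phi> i)" if "i \<in> I" for i
      using that f(1) linear_functional_on_convex[OF \<xi> S] unfolding \<phi>_def by simp
    have \<phi>_zero: "\<phi> i 0 = 0" if "i \<in> I" for i
      using that f(2) linear_functional_on_zero[OF \<xi> S] unfolding \<phi>_def by simp
    have split: "(\<Sum>i\<in>J. \<xi> i (d i)) + (\<Sum>i\<in>I - J. f i (d i)) = f j (d j) + (\<Sum>i\<in>I'. \<phi> i (d i))" for d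
    proof -
      have "(\<Sum>i\<in>I. \<phi> i (d i)) = (\<Sum>i\<in>J. \<phi> i (d i)) + (\<Sum>i\<in>I - J. \<phi> i (d i))"
        using I J by (simp add: add.commute sum.subset_diff)
      moreover have "(\<Sum>i\<in>I. \<phi> i (d i)) = \<phi> j (d j) + (\<Sum>i\<in>I'. \<phi> i (d i))"
        unfolding I'_def using I j by (simp add: sum.remove)
      ultimately show ?thesis using j by (simp add: \<phi>_def)
    qed
    have split': "(\<Sum>i\<in>insert j J. \<zeta> i (d i)) + (\<Sum>i\<in>I - insert j J. f i (d i))
        = \<zeta> j (d j) + (\<Sum>i\<in>I'. \<phi> i (d i))" if "\<And>i. i \<in> J \<Longrightarrow> \<zeta> i = \<xi> i" for \<zeta> d
    proof -
      have "I' = J \<union> (I - insert j J)" "J \<inter> (I - insert j J) = {}"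
        using j J unfolding I'_def by blast+
      then have "(\<Sum>i\<in>I'. \<phi> i (d i)) = (\<Sum>i\<in>J. \<phi> i (d i)) + (\<Sum>i\<in>I - insert j J. \<phi> i (d i))"
        using I insert.hyps(1) by (simp add: sum.union_disjoint)
      moreover have "(\<Sum>i\<in>J. \<phi> i (d i)) = (\<Sum>i\<in>J. \<zeta> i (d i))"
        using that by (intro sum.cong) (simp_all add: \<phi>_def)
      moreover have "(\<Sum>i\<in>I - insert j J. \<phi> i (d i)) = (\<Sum>i\<in>I - insert j J. f i (d i))"
        by (intro sum.cong) (simp_all add: \<phi>_def)
      ultimately show ?thesis using j insert.hyps(1) by simp
    qed
    define G where "G d = g d - (\<Sum>i\<in>I'. \<phi> i (d i))" for d
    have G: "u * G d + v * G e \<le> G (\<lambda>i. u *\<^sub>R d i + v *\<^sub>R e i)"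
      if "d \<in> D" "e \<in> D" "0 \<le> u" "0 \<le> v" "u + v = 1" for d e u v
    proof -
      have "(\<Sum>i\<in>I'. \<phi> i (u *\<^sub>R d i + v *\<^sub>R e i)) \<le> (\<Sum>i\<in>I'. u * \<phi> i (d i) + v * \<phi> i (e i))"
        using that D_sub \<phi>_convex unfolding I'_def by (intro sum_mono convex_on_combination) auto
      also have "\<dots> = u * (\<Sum>i\<in>I'. \<phi> i (d i)) + v * (\<Sum>i\<in>I'. \<phi> i (e i))"
        by (simp add: sum.distrib sum_distrib_left)
      finally show ?thesis using g[OF that] unfolding G_def by (simp add: algebra_simps)
    qed
    let ?K = "{(e, r). \<exists>d\<in>D. e = d j \<and> r \<le> G d}"
    have K_convex: "convex ?K"
    proof (rule convexI)
      fix a b and u v :: real assume "a \<in> ?K" "b \<in> ?K" and uv: "0 \<le> u" "0 \<le> v" "u + v = 1"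
      then obtain d e r s where *: "d \<in> D" "e \<in> D" "a = (d j, r)" "b = (e j, s)" "r \<le> G d" "s \<le> G e"
        by auto
      have "u * r + v * s \<le> u * G d + v * G e"
        using * uv by (intro add_mono mult_left_mono) auto
      also have "\<dots> \<le> G (\<lambda>i. u *\<^sub>R d i + v *\<^sub>R e i)" using * uv by (intro G)
      finally show "u *\<^sub>R a + v *\<^sub>R b \<in> ?K"
        using D_convex[OF *(1,2) uv] * by auto
    qed
    have K_sub: "?K \<subseteq> S j \<times> UNIV" using D_sub j by auto
    have K_zero: "(0, 0) \<in> ?K"
      using D_zero \<phi>_zero unfolding G_def I'_def by (auto intro!: bexI[where x = "\<lambda>i. 0"])
    have K_le: "r \<le> f j e" if er: "(e, r) \<in> ?K" for e r
    proof -
      obtain d where "d \<in> D" "e = d j" "r \<le> G d" using er by auto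
      then show ?thesis using g\<xi>[of d] unfolding split G_def by simp
    qed
    obtain \<eta> where \<eta>: "linear_functional_on (S j) \<eta>" "\<And>x. x \<in> S j \<Longrightarrow> \<eta> x \<le> f j x"
      and G\<eta>: "\<And>e r. (e, r) \<in> ?K \<Longrightarrow> r \<le> \<eta> e"
      using sandwich[OF S[OF j(1)] f(1)[OF j(1)] f(2)[OF j(1)] K_convex K_sub K_zero K_le] by blast
    let ?\<zeta> = "\<xi>(j := \<eta>)"
    have "g d \<le> (\<Sum>i\<in>insert j J. ?\<zeta> i (d i)) + (\<Sum>i\<in>I - insert j J. f i (d i))" if "d \<in> D" for d
    proof -
      have "G d \<le> \<eta> (d j)" using that by (intro G\<eta>) auto
      moreover have "?\<zeta> i = \<xi> i" if "i \<in> J" for i using that j by auto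
      ultimately show ?thesis unfolding G_def by (subst split') auto
    qed
    moreover have "\<forall>i\<in>insert j J. linear_functional_on (S i) (?\<zeta> i) \<and> (\<forall>x\<in>S i. ?\<zeta> i x \<le> f i x)"
      using \<eta> \<xi> \<xi>f by auto
    ultimately show ?case by blast
  qed
  from this[OF I order_refl] show ?thesis using that by auto
qed

lemma convex_on_translate:
  fixes f :: "'a::real_vector \<Rightarrow> real"
  assumes S: "subspace S" and f: "convex_on S f" and b: "b \<in> S"
  shows "convex_on S (\<lambda>v. f (b + v) - f b)"
  unfolding convex_on_def
proof (intro conjI ballI allI impI)
  show "convex S" using S by (rule subspace_imp_convex)
  fix x y and u v :: real assume x: "x \<in> S" and y: "y \<in> S" and uv: "0 \<le> u" "0 \<le> v" "u + v = 1"
  have b_split: "b = u *\<^sub>R b + v *\<^sub>R b" "f b = u * f b + v * f b"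
    using uv by (simp_all flip: scaleR_add_left distrib_right)
  have "b + (u *\<^sub>R x + v *\<^sub>R y) = u *\<^sub>R (b + x) + v *\<^sub>R (b + y)"
    by (subst b_split(1)) (simp add: algebra_simps)
  also have "f \<dots> \<le> u * f (b + x) + v * f (b + y)"
    using S b x y uv by (intro convex_on_combination[OF f] subspace_add)
  finally have "f (b + (u *\<^sub>R x + v *\<^sub>R y)) - f b \<le> u * f (b + x) + v * f (b + y) - (u * f b + v * f b)"
    using b_split(2) by linarith
  also have "\<dots> = u * (f (b + x) - f b) + v * (f (b + y) - f b)"
    by (simp add: algebra_simps)
  finally show "f (b + (u *\<^sub>R x + v *\<^sub>R y)) - f b \<le> u * (f (b + x) - f b) + v * (f (b + y) - f b)" .
qed

section \<open>Continuous functionals on subspaces\<close>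

text \<open>
  Sandwich: \<open>\<xi> y - \<xi> x = \<xi> (y - x)\<close> lies between \<open>- f (x - y)\<close> and \<open>f (y - x)\<close>.
\<close>

lemma linear_minorant_continuous:
  fixes f :: "'a::real_normed_vector \<Rightarrow> real"
  assumes S: "subspace S" and \<xi>: "linear_functional_on S \<xi>"
    and f: "continuous_on S f" "f 0 = 0" and le: "\<And>x. x \<in> S \<Longrightarrow> \<xi> x \<le> f x"
  shows "continuous_on S \<xi>"
  unfolding continuous_on_def
proof
  fix x assume x: "x \<in> S"
  have lim0: "((\<lambda>y. f (c y)) \<longlongrightarrow> 0) (at x within S)"
    if c: "continuous_on S c" "\<And>y. y \<in> S \<Longrightarrow> c y \<in> S" "c x = 0" for c
  proof -
    have "continuous_on S (\<lambda>y. f (c y))"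
      using c by (intro continuous_on_compose2[OF f(1) c(1)]) auto
    then show ?thesis using x c(3) f(2) unfolding continuous_on_def by auto
  qed
  have up: "((\<lambda>y. f (y - x)) \<longlongrightarrow> 0) (at x within S)"
    using S x by (intro lim0 continuous_intros subspace_diff) auto
  have "((\<lambda>y. f (x - y)) \<longlongrightarrow> 0) (at x within S)"
    using S x by (intro lim0 continuous_intros subspace_diff) auto
  then have lo: "((\<lambda>y. - f (x - y)) \<longlongrightarrow> 0) (at x within S)"
    using tendsto_minus by fastforce
  have diff: "\<xi> (y - z) = \<xi> y - \<xi> z" if "y \<in> S" "z \<in> S" for y z
  proof -
    have "\<xi> (y + - z) = \<xi> y + \<xi> (- z)"
      using \<xi> that subspace_neg[OF S that(2)] unfolding linear_functional_on_def by blast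
    then show ?thesis using linear_functional_on_minus[OF \<xi> that(2)] by simp
  qed
  have "((\<lambda>y. \<xi> y - \<xi> x) \<longlongrightarrow> 0) (at x within S)"
  proof (rule tendsto_sandwich[OF _ _ lo up])
    show "\<forall>\<^sub>F y in at x within S. \<xi> y - \<xi> x \<le> f (y - x)"
      unfolding eventually_at_filter
    proof (intro always_eventually allI impI)
      fix y assume "y \<in> S"
      then show "\<xi> y - \<xi> x \<le> f (y - x)"
        using le[of "y - x"] diff[OF _ x, of y] S x by (simp add: subspace_diff)
    qed
    show "\<forall>\<^sub>F y in at x within S. - f (x - y) \<le> \<xi> y - \<xi> x"
      unfolding eventually_at_filter
    proof (intro always_eventually allI impI)
      fix y assume "y \<in> S"
      then show "- f (x - y) \<le> \<xi> y - \<xi> x"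
        using le[of "x - y"] diff[OF x] S x by (simp add: subspace_diff)
    qed
  qed
  then show "(\<xi> \<longlongrightarrow> \<xi> x) (at x within S)" by (simp add: LIM_zero_iff)
qed

lemma continuous_linear_on_add:
  "continuous_linear_on V V' f \<Longrightarrow> x \<in> V \<Longrightarrow> y \<in> V \<Longrightarrow> f (x + y) = f x + f y"
  unfolding continuous_linear_on_def by blast

lemma continuous_linear_on_scale:
  "continuous_linear_on V V' f \<Longrightarrow> x \<in> V \<Longrightarrow> f (c *\<^sub>R x) = c *\<^sub>R f x"
  unfolding continuous_linear_on_def by blast

lemma continuous_linear_on_in:
  "continuous_linear_on V V' f \<Longrightarrow> x \<in> V \<Longrightarrow> f x \<in> V'"
  unfolding continuous_linear_on_def by blast

lemma continuous_linear_on_minus: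
  "continuous_linear_on V V' f \<Longrightarrow> x \<in> V \<Longrightarrow> f (- x) = - f x"
  using continuous_linear_on_scale[of V V' f x "-1"] by simp

lemma continuous_linear_on_diff:
  "continuous_linear_on V V' f \<Longrightarrow> subspace V \<Longrightarrow> x \<in> V \<Longrightarrow> y \<in> V \<Longrightarrow> f (x - y) = f x - f y"
  using continuous_linear_on_add[of V V' f x "- y"] continuous_linear_on_minus[of V V' f y]
  by (simp add: subspace_neg)

lemma continuous_linear_on_zero:
  "continuous_linear_on V V' f \<Longrightarrow> subspace V \<Longrightarrow> f 0 = 0"
  using continuous_linear_on_scale[of V V' f 0 0] by (simp add: subspace_0)

lemma dual_spaceD:
  "f \<in> dual_space V \<Longrightarrow> continuous_linear_on V UNIV f"
  "f \<in> dual_space V \<Longrightarrow> x \<notin> V \<Longrightarrow> f x = 0"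
  unfolding dual_space_def by auto

lemma dual_space_add:
  assumes "f \<in> dual_space V" "g \<in> dual_space V"
  shows "f + g \<in> dual_space V"
proof -
  have "continuous_on V (\<lambda>x. f x + g x)"
    using assms unfolding dual_space_def continuous_linear_on_def by (intro continuous_on_add) auto
  then show ?thesis
    using assms unfolding dual_space_def continuous_linear_on_def plus_fun_def
    by (simp add: algebra_simps)
qed

lemma dual_space_uminus:
  assumes "f \<in> dual_space V"
  shows "- f \<in> dual_space V"
proof -
  have "continuous_on V (\<lambda>x. - f x)"
    using assms unfolding dual_space_def continuous_linear_on_def by (intro continuous_on_minus) auto
  then show ?thesis
    using assms unfolding dual_space_def continuous_linear_on_def fun_Compl_def
    by simp
qed

text \<open>
  Besides adjoints of the system operators this covers restrictions of functionals on a product to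
  one factor, with \<open>L\<close> the inclusion of that factor.
\<close>

lemma adjoint_op_in_dual_space:
  assumes L: "continuous_linear_on V V' L" and y: "continuous_linear_on V' UNIV y"
    and V: "subspace V"
  shows "adjoint_op V L y \<in> dual_space V"
proof -
  have "continuous_on V (\<lambda>v. y (L v))"
    using L y unfolding continuous_linear_on_def
    by (intro continuous_on_compose2[of V' y V L]) auto
  then have "continuous_on V (adjoint_op V L y)"
    by (rule continuous_on_eq) (simp add: adjoint_op_def)
  then show ?thesis
    using L y V unfolding dual_space_def continuous_linear_on_def
    by (auto simp: adjoint_op_def subspace_add subspace_scale Pi_iff)
qed

section \<open>Costates and the optimality inequality\<close>

text \<open>
  The adjoint equation runs backwards in time, so \<open>p k\<close> is obtained by recursion on the time to go, \<open>N - k\<close>.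
\<close>

lemma costate_exists:
  fixes A :: "nat \<Rightarrow> 'x::real_normed_vector \<Rightarrow> 'x"
  assumes X: "\<And>k. k \<le> N \<Longrightarrow> subspace (X k)"
    and A: "\<And>k. k < N \<Longrightarrow> continuous_linear_on (X k) (X (Suc k)) (A k)"
    and a: "\<And>k. k \<le> N \<Longrightarrow> a k \<in> dual_space (X k)"
  obtains p where "p N = a N" "\<And>k. k < N \<Longrightarrow> p k = a k + adjoint_op (X k) (A k) (p (Suc k))"
    "\<And>k. k \<le> N \<Longrightarrow> p k \<in> dual_space (X k)"
proof -
  define q where "q = rec_nat (a N) (\<lambda>m r. a (N - Suc m) + adjoint_op (X (N - Suc m)) (A (N - Suc m)) r)"
  define p where "p k = q (N - k)" for k
  have pN: "p N = a N" by (simp add: p_def q_def)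
  have p_step: "p k = a k + adjoint_op (X k) (A k) (p (Suc k))" if k: "k < N" for k
  proof -
    have "N - k = Suc (N - Suc k)" "N - Suc (N - Suc k) = k" using k by auto
    then show ?thesis by (simp add: p_def q_def)
  qed
  have "p k \<in> dual_space (X k)" if "k \<le> N" for k
    using that
  proof (induction k rule: inc_induct)
    case base
    then show ?case using pN a by simp
  next
    case (step k)
    then have "adjoint_op (X k) (A k) (p (Suc k)) \<in> dual_space (X k)"
      using A X by (intro adjoint_op_in_dual_space[where V' = "X (Suc k)"]) (auto intro: dual_spaceD)
    then show ?case using \<open>k < N\<close> a by (subst p_step) (auto intro: dual_space_add)
  qed
  then show ?thesis using that pN p_step by blast
qed

text \<open>
  Discrete integration by parts: along a trajectory \<open>y\<close> of the linear system driven by \<open>c\<close>, the costate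
  turns the running pairing with \<open>a\<close> into a pairing with the initial state and the input. Indeed
  \<open>a k (y k) = p k (y k) - p (k + 1) (y (k + 1)) + p (k + 1) (c k)\<close>, and the first two terms telescope.
\<close>

lemma costate_pairing:
  fixes A :: "nat \<Rightarrow> 'x::real_normed_vector \<Rightarrow> 'x"
  assumes pN: "p N = a N"
    and p: "\<And>k. k < N \<Longrightarrow> p k = a k + adjoint_op (X k) (A k) (p (Suc k))"
    and p_dual: "\<And>k. k \<le> N \<Longrightarrow> p k \<in> dual_space (X k)"
    and A: "\<And>k. k < N \<Longrightarrow> A k \<in> X k \<rightarrow> X (Suc k)"
    and y: "\<And>k. k \<le> N \<Longrightarrow> y k \<in> X k" and c: "\<And>k. k < N \<Longrightarrow> c k \<in> X (Suc k)"
    and y_Suc: "\<And>k. k < N \<Longrightarrow> y (Suc k) = A k (y k) + c k"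
  shows "(\<Sum>k<N. a k (y k)) + a N (y N) = p 0 (y 0) + (\<Sum>k<N. p (Suc k) (c k))"
proof -
  have "a k (y k) = p k (y k) - p (Suc k) (y (Suc k)) + p (Suc k) (c k)" if k: "k < N" for k
  proof -
    have "A k (y k) \<in> X (Suc k)" using A[OF k] y[of k] k by auto
    moreover have "continuous_linear_on (X (Suc k)) UNIV (p (Suc k))"
      using p_dual[of "Suc k"] k by (intro dual_spaceD) auto
    ultimately have "p (Suc k) (y (Suc k)) = p (Suc k) (A k (y k)) + p (Suc k) (c k)"
      using c k y_Suc by (simp add: continuous_linear_on_add)
    then show ?thesis using p[OF k] y[of k] k by (simp add: adjoint_op_def)
  qed
  then have "(\<Sum>k<N. a k (y k))
      = (\<Sum>k<N. p k (y k) - p (Suc k) (y (Suc k))) + (\<Sum>k<N. p (Suc k) (c k))"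
    by (simp add: sum.distrib)
  then show ?thesis using pN sum_lessThan_telescope'[of "\<lambda>k. p k (y k)" N] by simp
qed

text \<open>
  A subgradient of the optimal value function makes \<open>(xb, ub, wb)\<close> a minimizer of the cost minus \<open>ws\<close>
  over states, controls and parameters jointly, since at \<open>wb\<close> the optimal value equals the cost of
  \<open>(xb, ub)\<close>, while at any other \<open>w\<close> it is at most the cost of a feasible process.
\<close>

lemma opt_value_subgradient_inequality:
  assumes sol: "(xb, ub) \<in> solutions N X U C \<Omega> A B T h hN wb"
    and ws: "ws \<in> subdifferential_prod {..<N} W (opt_value N X U C \<Omega> A B T h hN) wb"
    and w: "w \<in> PiE {..<N} W" and z: "z \<in> feasible N X U C \<Omega> A B T w"
  shows "(\<Sum>k<N. ws k (w k - wb k)) \<le> cost N h hN z w - cost N h hN (xb, ub) wb"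
proof -
  let ?V = "opt_value N X U C \<Omega> A B T h hN"
  have Vwb: "?V wb = ereal (cost N h hN (xb, ub) wb)"
    unfolding opt_value_def using sol unfolding solutions_def
    by (intro antisym INF_lower2 INF_greatest) auto
  have "?V w \<le> ereal (cost N h hN z w)"
    unfolding opt_value_def using z by (intro INF_lower)
  then have V_diff: "?V w - ?V wb \<le> ereal (cost N h hN z w) - ?V wb"
    by (intro ereal_minus_mono order_refl)
  have "ereal (pairing {..<N} ws (\<lambda>i. w i - wb i)) \<le> ?V w - ?V wb"
    using ws w unfolding subdifferential_prod_def by blast
  also note V_diff
  finally show ?thesis using Vwb by (simp add: pairing_def)
qed

text \<open>
  With \<open>J\<close> the inclusion of one factor of a product, the restriction of a subgradient to this factor
  is a partial subgradient, because moving along \<open>J\<close> changes only one argument.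
\<close>

lemma subdifferential_partial:
  assumes V: "subspace V" and J: "continuous_linear_on V S J" and \<xi>: "continuous_linear_on S UNIV \<xi>"
    and y: "y \<in> V" and le: "\<And>v. v \<in> V \<Longrightarrow> \<xi> (J v) \<le> f (y + v) - f y"
  shows "adjoint_op V J \<xi> \<in> subdifferential V (\<lambda>x. ereal (f x)) y"
  unfolding subdifferential_def
proof (intro CollectI conjI ballI)
  show "adjoint_op V J \<xi> \<in> dual_space V" by (rule adjoint_op_in_dual_space[OF J \<xi> V])
  fix z assume "z \<in> V"
  then have "z - y \<in> V" using V y by (simp add: subspace_diff)
  then show "ereal (adjoint_op V J \<xi> (z - y)) \<le> ereal (f z) - ereal (f y)"
    using le[of "z - y"] by (simp add: adjoint_op_def)
qed

section \<open>The optimality conditions\<close>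

theorem theorem3:
  fixes N :: nat
    and X :: "nat \<Rightarrow> 'x::real_normed_vector set"
    and U :: "nat \<Rightarrow> 'u::real_normed_vector set"
    and W :: "nat \<Rightarrow> 'w::real_normed_vector set"
    and C :: "'x set" and \<Omega> :: "nat \<Rightarrow> 'u set"
    and A :: "nat \<Rightarrow> 'x \<Rightarrow> 'x" and B :: "nat \<Rightarrow> 'u \<Rightarrow> 'x" and T :: "nat \<Rightarrow> 'w \<Rightarrow> 'x"
    and h :: "nat \<Rightarrow> 'x \<times> 'u \<times> 'w \<Rightarrow> real" and hN :: "'x \<Rightarrow> real"
    and xb :: "nat \<Rightarrow> 'x" and ub :: "nat \<Rightarrow> 'u" and wb :: "nat \<Rightarrow> 'w"
    and ws :: "nat \<Rightarrow> 'w \<Rightarrow> real"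
  assumes N: "N \<ge> 1"
    and X: "\<And>k. k \<le> N \<Longrightarrow> banach_subspace (X k)"
    and U: "\<And>k. k < N \<Longrightarrow> banach_subspace (U k)"
    and W: "\<And>k. k < N \<Longrightarrow> banach_subspace (W k)"
    and C: "C \<subseteq> X 0" "convex C"
    and \<Omega>: "\<And>k. k < N \<Longrightarrow> \<Omega> k \<subseteq> U k" "\<And>k. k < N \<Longrightarrow> convex (\<Omega> k)"
    and A: "\<And>k. k < N \<Longrightarrow> continuous_linear_on (X k) (X (Suc k)) (A k)"
    and B: "\<And>k. k < N \<Longrightarrow> continuous_linear_on (U k) (X (Suc k)) (B k)"
    and T: "\<And>k. k < N \<Longrightarrow> continuous_linear_on (W k) (X (Suc k)) (T k)"
    and h_convex: "\<And>k. k < N \<Longrightarrow> convex_on (X k \<times> U k \<times> W k) (h k)"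
    and hN_convex: "convex_on (X N) hN"
    and wb: "wb \<in> PiE {..<N} W"
    and V_finite: "\<bar>opt_value N X U C \<Omega> A B T h hN wb\<bar> \<noteq> \<infinity>"
    and sol: "(xb, ub) \<in> solutions N X U C \<Omega> A B T h hN wb"
    and h_cont: "\<And>k. k < N \<Longrightarrow> continuous_on (X k \<times> U k \<times> W k) (h k)"
    and hN_cont: "continuous_on (X N) hN"
    and \<Omega>_interior: "\<And>k. k < N \<Longrightarrow> (top_of_set (U k)) interior_of (\<Omega> k) \<noteq> {}"
    and ker: "ker_adjoint_prod (PiE {..<N} W) {1..N} X (T_op N T)
              \<subseteq> ker_adjoint_prod (PiE {..N} X \<times> PiE {..<N} U) {1..N} X (M_op N A B)"
    and closed_range:
      "closedin (product_topology (\<lambda>j. top_of_set (X j)) {1..N})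
         (Phi_op N A B T ` (PiE {..<N} W \<times> PiE {..N} X \<times> PiE {..<N} U))"
    and ws: "ws \<in> subdifferential_prod {..<N} W (opt_value N X U C \<Omega> A B T h hN) wb"
  shows "\<exists>x0s \<in> normal_cone (X 0) C (xb 0).
         \<exists>xs \<in> dual_prod {1..N} X.
         \<exists>us \<in> normal_cone_prod {..<N} U (PiE {..<N} \<Omega>) ub.
           xs N \<in> subdifferential (X N) (\<lambda>x. ereal (hN x)) (xb N) \<and>
           (\<forall>k\<in>{1..N - 1}.
              xs k \<in> (\<lambda>\<xi>. \<xi> + adjoint_op (X k) (A k) (xs (Suc k))) `
                subdifferential (X k) (\<lambda>x. ereal (h k (x, ub k, wb k))) (xb k)) \<and>
           x0s \<in> (\<lambda>\<xi>. - \<xi> - adjoint_op (X 0) (A 0) (xs 1)) `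
             subdifferential (X 0) (\<lambda>x. ereal (h 0 (x, ub 0, wb 0))) (xb 0) \<and>
           (\<forall>k<N.
              us k \<in> (\<lambda>\<xi>. - \<xi> - adjoint_op (U k) (B k) (xs (Suc k))) `
                subdifferential (U k) (\<lambda>u. ereal (h k (xb k, u, wb k))) (ub k)) \<and>
           (\<forall>k<N.
              ws k \<in> (\<lambda>\<xi>. \<xi> + adjoint_op (W k) (T k) (xs (Suc k))) `
                subdifferential (W k) (\<lambda>w. ereal (h k (xb k, ub k, w))) (wb k))"
proof -
  have Xs: "subspace (X k)" if "k \<le> N" for k
    using X[OF that] by (simp add: banach_subspace_def)
  have Us: "subspace (U k)" and Ws: "subspace (W k)" if "k < N" for k
    using U[OF that] W[OF that] by (simp_all add: banach_subspace_def)
  have feas: "(xb, ub) \<in> feasible N X U C \<Omega> A B T wb"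
    using sol by (simp add: solutions_def)
  then have xb: "xb \<in> PiE {..N} X" and ub: "ub \<in> PiE {..<N} U"
    and xb_Suc: "\<And>k. k < N \<Longrightarrow> xb (Suc k) = A k (xb k) + B k (ub k) + T k (wb k)"
    and ub_\<Omega>: "\<And>k. k < N \<Longrightarrow> ub k \<in> \<Omega> k" and xb_C: "xb 0 \<in> C"
    by (auto simp: feasible_def)
  have xbX: "xb k \<in> X k" if "k \<le> N" for k using xb that by auto
  have ubU: "ub k \<in> U k" and wbW: "wb k \<in> W k" if "k < N" for k using ub wb that by auto

  \<comment> \<open>The increase of the cost of stage \<open>k\<close> as a function \<open>f k\<close> of the perturbation of \<open>(xb k, ub k, wb k)\<close>. The terminal
    cost becomes stage \<open>N\<close>, on a space with trivial control and parameter components, so that all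
    stages live in one type.\<close>
  define S where "S k = (if k < N then X k \<times> U k \<times> W k else X N \<times> {0} \<times> {0})" for k
  define f where "f k = (if k < N then (\<lambda>v. h k ((xb k, ub k, wb k) + v) - h k (xb k, ub k, wb k))
      else (\<lambda>v. hN (xb N + fst v) - hN (xb N)))" for k
  have S_sub: "subspace (S k)" if "k \<le> N" for k
    unfolding S_def using that Xs Us Ws
    by (auto intro!: subspace_Times simp flip: zero_prod_def)
  have f_convex: "convex_on (S k) (f k)" if "k \<le> N" for k
  proof (cases "k < N")
    case True
    have "convex_on (X k \<times> U k \<times> W k) (\<lambda>v. h k ((xb k, ub k, wb k) + v) - h k (xb k, ub k, wb k))"
      using True Xs Us Ws xbX ubU wbW h_convex
      by (intro convex_on_translate) (auto intro!: subspace_Times)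
    then show ?thesis using True by (simp add: S_def f_def)
  next
    case False
    have "convex_on (X N) (\<lambda>v. hN (xb N + v) - hN (xb N))"
      using Xs xbX hN_convex by (intro convex_on_translate) auto
    then show ?thesis
      using False S_sub[OF that] subspace_imp_convex
      unfolding S_def f_def convex_on_def by fastforce
  qed
  have f_zero: "f k 0 = 0" for k by (simp add: f_def)
  have f_cont: "continuous_on (S k) (f k)" if "k \<le> N" for k
  proof (cases "k < N")
    case True
    have "continuous_on (X k \<times> U k \<times> W k) (\<lambda>v. h k ((xb k, ub k, wb k) + v))"
      using True Xs[of k] Us Ws xbX[of k] ubU wbW
      by (intro continuous_on_compose2[OF h_cont] continuous_intros) (auto simp: subspace_add)
    from continuous_on_diff[OF this continuous_on_const] show ?thesis
      using True by (simp add: S_def f_def)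
  next
    case False
    have "continuous_on (X N \<times> {0} \<times> {0}) (\<lambda>v. hN (xb N + fst v))"
      using Xs[of N] xbX[of N]
      by (intro continuous_on_compose2[OF hN_cont] continuous_intros) (auto simp: subspace_add)
    from continuous_on_diff[OF this continuous_on_const] show ?thesis
      using False by (simp add: S_def f_def)
  qed

  \<comment> \<open>\<open>D\<close> consists of the perturbations that lead to a process which is feasible for the perturbed
    parameter; the dynamics being linear, they satisfy the same recursion as the states.\<close>
  define D where "D = {d. (\<forall>k\<le>N. d k \<in> S k) \<and>
      (\<forall>k<N. fst (d (Suc k)) = A k (fst (d k)) + B k (fst (snd (d k))) + T k (snd (snd (d k)))) \<and>
      xb 0 + fst (d 0) \<in> C \<and> (\<forall>k<N. ub k + fst (snd (d k)) \<in> \<Omega> k)}"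
  define g where "g d = (\<Sum>k<N. ws k (snd (snd (d k))))" for d :: "nat \<Rightarrow> 'x \<times> 'u \<times> 'w"
  have ws_lin: "continuous_linear_on (W k) UNIV (ws k)" if "k < N" for k
    using ws that unfolding subdifferential_prod_def dual_prod_def
    by (intro dual_spaceD) auto
  have D_S: "d k \<in> S k" if "d \<in> D" "k \<le> N" for d k
    using that by (auto simp: D_def)
  have D_comp: "fst (d k) \<in> X k" "fst (snd (d k)) \<in> U k" "snd (snd (d k)) \<in> W k"
    if "d \<in> D" "k < N" for d k
    using D_S[OF that(1), of k] that(2) by (auto simp: S_def)
  have D_convex: "(\<lambda>i. u *\<^sub>R d i + v *\<^sub>R e i) \<in> D"
    and g_lin: "g (\<lambda>i. u *\<^sub>R d i + v *\<^sub>R e i) = u * g d + v * g e"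
    if d: "d \<in> D" and e: "e \<in> D" and uv: "0 \<le> u" "0 \<le> v" "u + v = 1" for d e u v
  proof -
    let ?c = "\<lambda>i. u *\<^sub>R d i + v *\<^sub>R e i"
    have lin: "L (u *\<^sub>R x + v *\<^sub>R y) = u *\<^sub>R L x + v *\<^sub>R L y"
      if "continuous_linear_on V V' L" "subspace V" "x \<in> V" "y \<in> V"
      for V :: "'p::real_normed_vector set" and V' :: "'q::real_normed_vector set" and L x y
      using that by (simp add: continuous_linear_on_add continuous_linear_on_scale subspace_scale)
    have transl: "b + (u *\<^sub>R x + v *\<^sub>R y) \<in> Q" if "convex Q" "b + x \<in> Q" "b + y \<in> Q"
      for Q :: "'p::real_normed_vector set" and b x y
    proof -
      have "u *\<^sub>R (b + x) + v *\<^sub>R (b + y) \<in> Q" using that uv by (intro convexD)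
      moreover have "u *\<^sub>R (b + x) + v *\<^sub>R (b + y) = (u + v) *\<^sub>R b + (u *\<^sub>R x + v *\<^sub>R y)"
        by (simp add: algebra_simps)
      ultimately show ?thesis using uv by simp
    qed
    have "fst (?c (Suc k)) = A k (fst (?c k)) + B k (fst (snd (?c k))) + T k (snd (snd (?c k)))"
      if k: "k < N" for k
    proof -
      have "fst (d (Suc k)) = A k (fst (d k)) + B k (fst (snd (d k))) + T k (snd (snd (d k)))"
        "fst (e (Suc k)) = A k (fst (e k)) + B k (fst (snd (e k))) + T k (snd (snd (e k)))"
        using d e k by (auto simp: D_def)
      then show ?thesis
        using lin[OF A[OF k]] lin[OF B[OF k]] lin[OF T[OF k]] Xs Us Ws k D_comp[OF d k] D_comp[OF e k]
        by (simp add: algebra_simps)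
    qed
    moreover have "?c k \<in> S k" if "k \<le> N" for k
      using S_sub[OF that] D_S[OF d that] D_S[OF e that] by (intro subspace_add subspace_scale)
    moreover have "xb 0 + fst (?c 0) \<in> C"
      using transl[OF C(2)] d e by (simp add: D_def)
    moreover have "ub k + fst (snd (?c k)) \<in> \<Omega> k" if "k < N" for k
      using transl[OF \<Omega>(2)[OF that]] d e that by (simp add: D_def)
    ultimately show "?c \<in> D" unfolding D_def by blast
    have "ws k (snd (snd (?c k))) = u * ws k (snd (snd (d k))) + v * ws k (snd (snd (e k)))"
      if k: "k < N" for k
      using lin[OF ws_lin[OF k] Ws[OF k] D_comp(3)[OF d k] D_comp(3)[OF e k]] by simp
    then show "g ?c = u * g d + v * g e"
      unfolding g_def by (simp add: sum.distrib sum_distrib_left)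
  qed
  have A0: "A k 0 = 0" and B0: "B k 0 = 0" and T0: "T k 0 = 0" and ws0: "ws k 0 = 0" if k: "k < N" for k
    using continuous_linear_on_zero[OF A[OF k] Xs] continuous_linear_on_zero[OF B[OF k] Us]
      continuous_linear_on_zero[OF T[OF k] Ws] continuous_linear_on_zero[OF ws_lin[OF k] Ws] k
    by auto
  have D_zero: "(\<lambda>i. 0) \<in> D"
    unfolding D_def using S_sub xb_C ub_\<Omega> A0 B0 T0 by (auto simp: subspace_0)
  have g_zero: "g (\<lambda>i. 0) = 0"
    using ws0 by (simp add: g_def)
  \<comment> \<open>Optimality of \<open>(xb, ub, wb)\<close>, written in terms of perturbations.\<close>
  have gf: "g d \<le> (\<Sum>k\<le>N. f k (d k))" if d: "d \<in> D" for d
  proof -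
    define x where "x = (\<lambda>k\<in>{..N}. xb k + fst (d k))"
    define u where "u = (\<lambda>k\<in>{..<N}. ub k + fst (snd (d k)))"
    define w where "w = (\<lambda>k\<in>{..<N}. wb k + snd (snd (d k)))"
    have dX: "fst (d k) \<in> X k" if "k \<le> N" for k
      using D_S[OF d that] that by (auto simp: S_def split: if_splits)
    have xP: "x \<in> PiE {..N} X" and uP: "u \<in> PiE {..<N} U" and wP: "w \<in> PiE {..<N} W"
      using dX D_comp[OF d] xbX ubU wbW Xs Us Ws
      by (auto simp: x_def u_def w_def subspace_add)
    have "x (Suc k) = A k (x k) + B k (u k) + T k (w k)" if k: "k < N" for k
    proof -
      have "fst (d (Suc k)) = A k (fst (d k)) + B k (fst (snd (d k))) + T k (snd (snd (d k)))"
        using d k by (auto simp: D_def)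
      moreover have "A k (xb k + fst (d k)) = A k (xb k) + A k (fst (d k))"
        "B k (ub k + fst (snd (d k))) = B k (ub k) + B k (fst (snd (d k)))"
        "T k (wb k + snd (snd (d k))) = T k (wb k) + T k (snd (snd (d k)))"
        using A B T k D_comp[OF d k] xbX[of k] ubU[OF k] wbW[OF k]
        by (auto intro!: continuous_linear_on_add)
      ultimately show ?thesis using k xb_Suc[OF k] by (simp add: x_def u_def w_def)
    qed
    moreover have "u k \<in> \<Omega> k" if "k < N" for k using d that by (simp add: u_def D_def)
    moreover have "x 0 \<in> C" using d by (simp add: x_def D_def)
    ultimately have "(x, u) \<in> feasible N X U C \<Omega> A B T w"
      using xP uP by (simp add: feasible_def)
    from opt_value_subgradient_inequality[OF sol ws wP this]
    have "(\<Sum>k<N. ws k (w k - wb k)) \<le> cost N h hN (x, u) w - cost N h hN (xb, ub) wb" .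
    moreover have "(\<Sum>k<N. ws k (w k - wb k)) = g d"
      unfolding g_def w_def by (intro sum.cong) auto
    moreover have "cost N h hN (x, u) w - cost N h hN (xb, ub) wb = (\<Sum>k<N. f k (d k)) + f N (d N)"
    proof -
      have "f k (d k) = h k (x k, u k, w k) - h k (xb k, ub k, wb k)" if "k < N" for k
        using that by (cases "d k") (simp add: f_def x_def u_def w_def)
      then show ?thesis
        by (simp add: cost_def sum_subtractf) (simp add: f_def x_def)
    qed
    ultimately show ?thesis by (simp flip: lessThan_Suc_atMost)
  qed

  \<comment> \<open>Full subgradients \<open>\<xi> k\<close> of the stage costs that still satisfy the optimality inequality on \<open>D\<close>.\<close>
  obtain \<xi> where \<xi>_lin: "\<And>k. k \<le> N \<Longrightarrow> linear_functional_on (S k) (\<xi> k)"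
    and \<xi>_le: "\<And>k v. k \<le> N \<Longrightarrow> v \<in> S k \<Longrightarrow> \<xi> k v \<le> f k v"
    and \<xi>_g: "\<And>d. d \<in> D \<Longrightarrow> g d \<le> (\<Sum>k\<le>N. \<xi> k (d k))"
  proof (rule sandwich_sum[of "{..N}" S f D g])
    show "u * g d + v * g e \<le> g (\<lambda>i. u *\<^sub>R d i + v *\<^sub>R e i)"
      if "d \<in> D" "e \<in> D" "0 \<le> u" "0 \<le> v" "u + v = 1" for d e u v
      using g_lin[OF that] by simp
  qed (use S_sub f_convex f_zero D_S D_convex D_zero g_zero gf in auto)
  have \<xi>_cl: "continuous_linear_on (S k) UNIV (\<xi> k)" if k: "k \<le> N" for k
    using linear_minorant_continuous[OF S_sub[OF k] \<xi>_lin[OF k] f_cont[OF k] f_zero \<xi>_le[OF k]] \<xi>_lin[OF k]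
    unfolding continuous_linear_on_def linear_functional_on_def by auto

  \<comment> \<open>The three components of \<open>\<xi> k\<close>, which are partial subgradients.\<close>
  define a where "a k = adjoint_op (X k) (\<lambda>x. (x, 0, 0)) (\<xi> k)" for k
  define b where "b k = adjoint_op (U k) (\<lambda>u. (0, u, 0)) (\<xi> k)" for k
  define c where "c k = adjoint_op (W k) (\<lambda>w. (0, 0, w)) (\<xi> k)" for k
  have inX: "continuous_linear_on (X k) (S k) (\<lambda>x. (x, 0, 0))" if "k \<le> N" for k
    using that Us Ws unfolding continuous_linear_on_def S_def
    by (auto intro!: continuous_intros simp: subspace_0)
  have inU: "continuous_linear_on (U k) (S k) (\<lambda>u. (0, u, 0))"
    and inW: "continuous_linear_on (W k) (S k) (\<lambda>w. (0, 0, w))" if "k < N" for k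
    using that Xs[of k] Us Ws unfolding continuous_linear_on_def S_def
    by (auto intro!: continuous_intros simp: subspace_0)
  have a_dual: "a k \<in> dual_space (X k)" if "k \<le> N" for k
    unfolding a_def using that inX \<xi>_cl Xs by (intro adjoint_op_in_dual_space)
  have b_dual: "b k \<in> dual_space (U k)" and c_dual: "c k \<in> dual_space (W k)" if "k < N" for k
    unfolding b_def c_def using that inU inW \<xi>_cl Us Ws by (auto intro!: adjoint_op_in_dual_space)
  have aN_sub: "a N \<in> subdifferential (X N) (\<lambda>x. ereal (hN x)) (xb N)"
    unfolding a_def
  proof (rule subdifferential_partial[OF Xs inX \<xi>_cl])
    fix v assume "v \<in> X N"
    then show "\<xi> N (v, 0, 0) \<le> hN (xb N + v) - hN (xb N)"
      using \<xi>_le[of N "(v, 0, 0)"] by (simp add: S_def f_def)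
  qed (use xbX in auto)
  have a_sub: "a k \<in> subdifferential (X k) (\<lambda>x. ereal (h k (x, ub k, wb k))) (xb k)" if k: "k < N" for k
    unfolding a_def
  proof (rule subdifferential_partial[OF Xs inX \<xi>_cl])
    fix v assume "v \<in> X k"
    then show "\<xi> k (v, 0, 0) \<le> h k (xb k + v, ub k, wb k) - h k (xb k, ub k, wb k)"
      using \<xi>_le[of k "(v, 0, 0)"] k Us Ws by (simp add: S_def f_def subspace_0)
  qed (use xbX k in auto)
  have b_sub: "b k \<in> subdifferential (U k) (\<lambda>u. ereal (h k (xb k, u, wb k))) (ub k)" if k: "k < N" for k
    unfolding b_def
  proof (rule subdifferential_partial[OF Us inU \<xi>_cl])
    fix v assume "v \<in> U k"
    then show "\<xi> k (0, v, 0) \<le> h k (xb k, ub k + v, wb k) - h k (xb k, ub k, wb k)"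
      using \<xi>_le[of k "(0, v, 0)"] k Xs[of k] Ws by (simp add: S_def f_def subspace_0)
  qed (use ubU k in auto)
  have c_sub: "c k \<in> subdifferential (W k) (\<lambda>w. ereal (h k (xb k, ub k, w))) (wb k)" if k: "k < N" for k
    unfolding c_def
  proof (rule subdifferential_partial[OF Ws inW \<xi>_cl])
    fix v assume "v \<in> W k"
    then show "\<xi> k (0, 0, v) \<le> h k (xb k, ub k, wb k + v) - h k (xb k, ub k, wb k)"
      using \<xi>_le[of k "(0, 0, v)"] k Xs[of k] Us by (simp add: S_def f_def subspace_0)
  qed (use wbW k in auto)

  obtain p where pN: "p N = a N"
    and p: "\<And>k. k < N \<Longrightarrow> p k = a k + adjoint_op (X k) (A k) (p (Suc k))"
    and p_dual: "\<And>k. k \<le> N \<Longrightarrow> p k \<in> dual_space (X k)"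
    using costate_exists[of N X A a, OF Xs A a_dual] by blast
  have p_cl: "continuous_linear_on (X k) UNIV (p k)" if "k \<le> N" for k
    using p_dual[OF that] by (rule dual_spaceD)

  \<comment> \<open>The initial state, the controls and the parameters can be perturbed independently; the states
    follow from the dynamics and are eliminated by the costate. All optimality conditions are
    read off from this inequality by switching on one of the perturbations at a time.\<close>
  have key: "(\<Sum>k<N. ws k (dw k)) \<le> p 0 dx0 + (\<Sum>k<N. b k (du k) + p (Suc k) (B k (du k)))
      + (\<Sum>k<N. c k (dw k) + p (Suc k) (T k (dw k)))"
    if dx0: "dx0 \<in> X 0" "xb 0 + dx0 \<in> C"
      and du: "\<And>k. k < N \<Longrightarrow> du k \<in> U k" "\<And>k. k < N \<Longrightarrow> ub k + du k \<in> \<Omega> k"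
      and dw: "\<And>k. k < N \<Longrightarrow> dw k \<in> W k"
    for dx0 du dw
  proof -
    define dx where "dx = rec_nat dx0 (\<lambda>k y. A k y + (B k (du k) + T k (dw k)))"
    have dx_0: "dx 0 = dx0" and dx_Suc: "dx (Suc k) = A k (dx k) + (B k (du k) + T k (dw k))" for k
      by (simp_all add: dx_def)
    have BX: "B k (du k) \<in> X (Suc k)" and TX: "T k (dw k) \<in> X (Suc k)" if "k < N" for k
      using continuous_linear_on_in[OF B] continuous_linear_on_in[OF T] du dw that by blast+
    have dxX: "dx k \<in> X k" if "k \<le> N" for k
      using that
    proof (induction k)
      case (Suc k)
      then show ?case
        unfolding dx_Suc using BX TX Xs[of "Suc k"] continuous_linear_on_in[OF A]
        by (auto intro!: subspace_add)
    qed (simp add: dx_0 dx0)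
    define d where "d k = (if k < N then (dx k, du k, dw k) else (dx k, 0, 0))" for k
    have "d \<in> D"
      unfolding D_def S_def d_def using dxX dx0 du dw dx_0 dx_Suc N by auto
    from \<xi>_g[OF this] have "g d \<le> (\<Sum>k<N. \<xi> k (d k)) + \<xi> N (d N)"
      by (simp flip: lessThan_Suc_atMost)
    moreover have "g d = (\<Sum>k<N. ws k (dw k))" by (simp add: g_def d_def)
    moreover have "\<xi> k (d k) = a k (dx k) + (b k (du k) + c k (dw k))" if k: "k < N" for k
    proof -
      have "(dx k, 0, 0) \<in> S k" "(0, du k, 0) \<in> S k" "(0, 0, dw k) \<in> S k"
        "(0, du k, dw k) \<in> S k"
        using k dxX[of k] du dw Xs[of k] Us Ws by (auto simp: S_def subspace_0)
      then have "\<xi> k ((dx k, 0, 0) + ((0, du k, 0) + (0, 0, dw k)))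
          = \<xi> k (dx k, 0, 0) + (\<xi> k (0, du k, 0) + \<xi> k (0, 0, dw k))"
        using k by (simp del: add_Pair add: continuous_linear_on_add[OF \<xi>_cl] subspace_add[OF S_sub])
      then show ?thesis
        using k dxX[of k] du dw by (simp add: d_def a_def b_def c_def adjoint_op_def)
    qed
    moreover have "\<xi> N (d N) = a N (dx N)"
      using dxX by (simp add: d_def a_def adjoint_op_def)
    moreover have "(\<Sum>k<N. a k (dx k)) + a N (dx N)
        = p 0 (dx 0) + (\<Sum>k<N. p (Suc k) (B k (du k) + T k (dw k)))"
    proof (rule costate_pairing[of p N a X A, OF pN p p_dual])
      show "A k \<in> X k \<rightarrow> X (Suc k)" if "k < N" for k using continuous_linear_on_in[OF A[OF that]] by blast
      show "B k (du k) + T k (dw k) \<in> X (Suc k)" if "k < N" for k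
        using that BX TX Xs by (intro subspace_add) auto
    qed (use dxX dx_Suc in auto)
    moreover have "p (Suc k) (B k (du k) + T k (dw k)) = p (Suc k) (B k (du k)) + p (Suc k) (T k (dw k))"
      if "k < N" for k
      using that BX TX by (intro continuous_linear_on_add[OF p_cl]) auto
    ultimately show ?thesis by (simp add: sum.distrib dx_0)
  qed

  have b0: "b k 0 = 0" and c0: "c k 0 = 0" and p0: "p (Suc k) 0 = 0" if k: "k < N" for k
    using continuous_linear_on_zero[OF dual_spaceD(1)[OF b_dual[OF k]] Us]
      continuous_linear_on_zero[OF dual_spaceD(1)[OF c_dual[OF k]] Ws]
      continuous_linear_on_zero[OF p_cl Xs, of "Suc k"] k
    by auto

  have p0_C: "0 \<le> p 0 (x - xb 0)" if "x \<in> C" for x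
    using key[of "x - xb 0" "\<lambda>k. 0" "\<lambda>k. 0"] that C(1) Xs[of 0] Us Ws xbX[of 0] ub_\<Omega> b0 c0 B0 T0 ws0 p0
    by (auto simp: subspace_0 subspace_diff)
  have u_\<Omega>: "0 \<le> (\<Sum>k<N. b k (u k - ub k) + p (Suc k) (B k (u k - ub k)))"
    if u: "u \<in> PiE {..<N} \<Omega>" for u
  proof -
    have uk: "u k \<in> \<Omega> k" if "k < N" for k using u that by auto
    have "u k - ub k \<in> U k" if "k < N" for k
      using uk[OF that] \<Omega>(1)[OF that] Us ubU that by (auto intro: subspace_diff)
    then show ?thesis
      using key[of 0 "\<lambda>k. u k - ub k" "\<lambda>k. 0"] Xs[of 0] Ws xb_C uk c0 T0 ws0 p0
        continuous_linear_on_zero[OF p_cl[of 0]]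
      by (auto simp: subspace_0)
  qed
  \<comment> \<open>The parameters range over the whole space, so the inequality for \<open>v\<close> and for \<open>- v\<close> gives equality.\<close>
  have w_eq: "ws k v = c k v + p (Suc k) (T k v)" if k: "k < N" and v: "v \<in> W k" for k v
  proof -
    have le: "ws k v \<le> c k v + p (Suc k) (T k v)" if v: "v \<in> W k" for v
    proof -
      let ?dw = "\<lambda>i. if i = k then v else 0"
      have "(\<Sum>i<N. ws i (?dw i)) = (\<Sum>i<N. if i = k then ws k v else 0)"
        using ws0 by (intro sum.cong) auto
      moreover have "(\<Sum>i<N. c i (?dw i) + p (Suc i) (T i (?dw i)))
          = (\<Sum>i<N. if i = k then c k v + p (Suc k) (T k v) else 0)"
        using c0 T0 p0 by (intro sum.cong) auto
      moreover have "(\<Sum>i<N. ws i (?dw i)) \<le> p 0 0 + (\<Sum>i<N. b i 0 + p (Suc i) (B i 0))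
          + (\<Sum>i<N. c i (?dw i) + p (Suc i) (T i (?dw i)))"
        using Xs[of 0] Us Ws xb_C ub_\<Omega> v by (intro key) (auto simp: subspace_0)
      ultimately show ?thesis
        using k b0 B0 p0 continuous_linear_on_zero[OF p_cl[of 0] Xs[of 0]] by (simp add: sum.delta)
    qed
    have "T k v \<in> X (Suc k)" using continuous_linear_on_in[OF T[OF k] v] .
    then have "p (Suc k) (T k (- v)) = - p (Suc k) (T k v)"
      using continuous_linear_on_minus[OF T[OF k] v] continuous_linear_on_minus[OF p_cl[of "Suc k"]] k
      by simp
    moreover have "c k (- v) = - c k v" "ws k (- v) = - ws k v"
      using continuous_linear_on_minus[OF dual_spaceD(1)[OF c_dual[OF k]] v]
        continuous_linear_on_minus[OF ws_lin[OF k] v] by auto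
    moreover have "- v \<in> W k" using Ws[OF k] v by (rule subspace_neg)
    ultimately show ?thesis using le[OF v] le[of "- v"] by simp
  qed

  define xs where "xs = (\<lambda>k\<in>{1..N}. p k)"
  define us where "us = (\<lambda>k\<in>{..<N}. - b k - adjoint_op (U k) (B k) (p (Suc k)))"
  have xs: "xs k = p k" if "1 \<le> k" "k \<le> N" for k using that by (simp add: xs_def)
  show ?thesis
  proof (intro bexI conjI ballI allI impI)
    show "- p 0 \<in> normal_cone (X 0) C (xb 0)"
      unfolding normal_cone_def using p0_C p_dual[of 0] by (auto intro: dual_space_uminus)
    show "xs \<in> dual_prod {1..N} X"
      unfolding dual_prod_def xs_def using p_dual by auto
    show "us \<in> normal_cone_prod {..<N} U (PiE {..<N} \<Omega>) ub"
      unfolding normal_cone_prod_def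
    proof (intro CollectI conjI ballI)
      have "- (b k + adjoint_op (U k) (B k) (p (Suc k))) \<in> dual_space (U k)" if "k < N" for k
        using that B p_cl Us b_dual
        by (intro dual_space_uminus dual_space_add adjoint_op_in_dual_space[where V' = "X (Suc k)"]) auto
      then show "us \<in> dual_prod {..<N} U"
        unfolding dual_prod_def us_def by auto
      fix u assume u: "u \<in> PiE {..<N} \<Omega>"
      have "u k - ub k \<in> U k" if "k < N" for k
        using u \<Omega>(1)[OF that] Us ubU that by (intro subspace_diff) auto
      then have "pairing {..<N} us (\<lambda>i. u i - ub i)
          = (\<Sum>k<N. - (b k (u k - ub k) + p (Suc k) (B k (u k - ub k))))"
        unfolding pairing_def us_def by (intro sum.cong) (auto simp: adjoint_op_def)
      then show "pairing {..<N} us (\<lambda>i. u i - ub i) \<le> 0"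
        using u_\<Omega>[OF u] by (simp only: sum_negf neg_le_0_iff_le)
    qed
    show "xs N \<in> subdifferential (X N) (\<lambda>x. ereal (hN x)) (xb N)"
      using aN_sub pN N by (simp add: xs)
    show "xs k \<in> (\<lambda>\<xi>. \<xi> + adjoint_op (X k) (A k) (xs (Suc k))) `
        subdifferential (X k) (\<lambda>x. ereal (h k (x, ub k, wb k))) (xb k)" if "k \<in> {1..N - 1}" for k
    proof (rule image_eqI)
      have k: "1 \<le> k" "k < N" using that by auto
      show "xs k = a k + adjoint_op (X k) (A k) (xs (Suc k))" using p k by (simp add: xs)
      show "a k \<in> subdifferential (X k) (\<lambda>x. ereal (h k (x, ub k, wb k))) (xb k)" using k by (intro a_sub)
    qed
    show "- p 0 \<in> (\<lambda>\<xi>. - \<xi> - adjoint_op (X 0) (A 0) (xs 1)) `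
        subdifferential (X 0) (\<lambda>x. ereal (h 0 (x, ub 0, wb 0))) (xb 0)"
    proof (rule image_eqI)
      show "- p 0 = - a 0 - adjoint_op (X 0) (A 0) (xs 1)" using p[of 0] N by (simp add: xs)
      show "a 0 \<in> subdifferential (X 0) (\<lambda>x. ereal (h 0 (x, ub 0, wb 0))) (xb 0)"
        using N by (intro a_sub) auto
    qed
    show "us k \<in> (\<lambda>\<xi>. - \<xi> - adjoint_op (U k) (B k) (xs (Suc k))) `
        subdifferential (U k) (\<lambda>u. ereal (h k (xb k, u, wb k))) (ub k)" if k: "k < N" for k
    proof (rule image_eqI)
      show "us k = - b k - adjoint_op (U k) (B k) (xs (Suc k))" using k by (simp add: us_def xs)
    qed (rule b_sub[OF k])
    show "ws k \<in> (\<lambda>\<xi>. \<xi> + adjoint_op (W k) (T k) (xs (Suc k))) `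
        subdifferential (W k) (\<lambda>w. ereal (h k (xb k, ub k, w))) (wb k)" if k: "k < N" for k
    proof (rule image_eqI)
      have "ws k \<in> dual_space (W k)"
        using ws k unfolding subdifferential_prod_def dual_prod_def by auto
      then show "ws k = c k + adjoint_op (W k) (T k) (xs (Suc k))"
        using w_eq[OF k] k dual_spaceD(2)[OF c_dual[OF k]] dual_spaceD(2)[of "ws k" "W k"]
        by (auto simp: fun_eq_iff adjoint_op_def xs)
    qed (rule c_sub[OF k])
  qed
qed

end
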